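(* Let $G$ be a countable discrete abelian group, and let $\varphi,\psi:G\to G$ be homomorphisms such that $\varphi(G)$, $\psi(G)$ and $(\varphi-\psi)(G)$ all have finite index in $G$. Then for any ergodic measure-preserving $G$-system $(X,\mathcal{B},\mu,(T_g)_{g\in G})$, any $\varepsilon>0$, and any $A\in\mathcal{B}$, the set $$\left\{ g\in G : \mu\left(A\cap T_{\varphi(g)}^{-1}A\cap T_{\psi(g)}^{-1}A\right) > \mu(A)^3-\varepsilon\right\}$$ is syndetic in $G$.
   Context: A measure-preserving $G$-system is a separable probability space $(X,\mathcal{B},\mu)$ with an action of $G$ by measure-preserving automorphisms $T_g$; it is ergodic if every $A\in\mathcal B$ with $T_g^{-1}A=A$ for all $g$ has measure $0$ or $1$. A subset $S\subseteq G$ is syndetic if there are $g_1,\dots,g_k\in G$ with $G=\bigcup_{i=1}^k (g_i+S)$. *)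

theory Defs
  imports "HOL-Probability.Probability" "HOL-Library.Countable"
begin

definition additive_hom :: "('g::ab_group_add \<Rightarrow> 'g) \<Rightarrow> bool" where
  "additive_hom f \<longleftrightarrow> (\<forall>x y. f (x + y) = f x + f y)"

definition finite_index :: "'g::ab_group_add set \<Rightarrow> bool" where
  "finite_index H \<longleftrightarrow> finite {(\<lambda>h. g + h) ` H | g. True}"

definition syndetic :: "'g::ab_group_add set \<Rightarrow> bool" where
  "syndetic S \<longleftrightarrow> (\<exists>F. finite F \<and> UNIV = (\<Union>g\<in>F. (\<lambda>s. g + s) ` S))"

definition separable_measure :: "'x measure \<Rightarrow> bool" where
  "separable_measure M \<longleftrightarrow> (\<exists>C. countable C \<and> C \<subseteq> sets M \<and>
     (\<forall>A\<in>sets M. \<forall>e>0. \<exists>B\<in>C. measure M ((A - B) \<union> (B - A)) < e))"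

text \<open>Measure-preserving G-system: an action g \<mapsto> T g of G by measure-preserving
  maps (automatically automorphisms, as T (-g) inverts T g).\<close>
definition mp_system :: "'x measure \<Rightarrow> ('g::ab_group_add \<Rightarrow> 'x \<Rightarrow> 'x) \<Rightarrow> bool" where
  "mp_system M T \<longleftrightarrow> prob_space M \<and> separable_measure M \<and>
     (\<forall>g. T g \<in> M \<rightarrow>\<^sub>M M \<and> distr M M (T g) = M) \<and>
     (\<forall>x\<in>space M. T 0 x = x) \<and>
     (\<forall>g h. \<forall>x\<in>space M. T (g + h) x = T g (T h x))"

definition ergodic_system :: "'x measure \<Rightarrow> ('g::ab_group_add \<Rightarrow> 'x \<Rightarrow> 'x) \<Rightarrow> bool" where
  "ergodic_system M T \<longleftrightarrow> mp_system M T \<and>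
     (\<forall>A\<in>sets M. (\<forall>g. T g -` A \<inter> space M = A) \<longrightarrow> measure M A = 0 \<or> measure M A = 1)"

end

theory Submission
  imports Defs
begin

text \<open>
  Write \<open>U\<^sub>g f = f \<circ> T\<^sub>g\<close> and split \<open>1\<^sub>A = k + u\<close>, where \<open>k\<close> is the orthogonal projection of \<open>1\<^sub>A\<close>
  onto the functions with totally bounded orbit in \<open>L\<^sup>2\<close>. This \<open>k\<close> takes values in \<open>[0, 1]\<close>, and
  \<open>\<integral> 1\<^sub>A k\<^sup>2 = \<integral> k\<^sup>3 \<ge> \<mu>(A)\<^sup>3\<close>. Hence \<open>\<integral> 1\<^sub>A U\<^bsub>\<phi>(g)\<^esub>k U\<^bsub>\<psi>(g)\<^esub>k\<close> is almost as large as \<open>\<mu>(A)\<^sup>3\<close> when \<open>\<phi>(g)\<close>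
  and \<open>\<psi>(g)\<close> almost fix \<open>k\<close>. The weight
  \<open>w(g) = (1 + \<langle>U\<^bsub>\<phi>(g)\<^esub>k, k\<rangle> + \<langle>U\<^bsub>\<psi>(g)\<^esub>k, k\<rangle>)\<^sup>n\<close> with \<open>n\<close> large concentrates on these \<open>g\<close>, which form a
  syndetic set, and it is of positive type.

  The remaining terms contain \<open>u\<close>, and their averages against \<open>w\<close> vanish by van der Corput's
  argument: the correlations reduce to averages over \<open>(\<psi> - \<phi>)(G)\<close>, whose invariant functions form
  a finite-dimensional space because the index is finite and the system is ergodic, and \<open>u\<close> is weakly
  mixing along \<open>\<phi>(G)\<close> and \<open>\<psi>(G)\<close>. Averages are taken over finite lists of group elements, uniformly over
  all translates; this makes Foelner sequences unnecessary and yields syndeticity directly.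
\<close>

section \<open>Averages and kernels of positive type\<close>

text \<open>Restricting the averages to the good \<open>g\<close> would ruin the error estimate. Van
  der Corput's inequality turns a factor w(g) into w(g + h) w(g + h'), which still depends on g, and
  an indicator function is not of positive type. Polynomials with nonnegative coefficients in matrix
  coefficients are of positive type by Schur's product theorem, so w(t - s) can be absorbed into a
  Gram kernel; the high power is what lets such a function imitate an indicator. Ergodicity is given
  for the whole group only, and its restrictions to \<phi>(G) and \<psi>(G) may fail to be ergodic.
  Almost periodicity therefore refers to the full orbit, and finite index carries total boundedness
  from a \<phi>(G)-orbit to the full one. The index of \<phi> - \<psi> bounds the number of test
  functions needed to control every invariant limit, independently of the correlation considered. No
  spectral theory and no tensor product space enters: projections come from minimisation, and the
  Hilbert space inequalities are instances of \<open>psd_Cauchy_Schwarz\<close>.\<close>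

definition avg :: "'a list \<Rightarrow> ('a \<Rightarrow> real) \<Rightarrow> real" where
  "avg \<nu> F = (\<Sum>t\<leftarrow>\<nu>. F t) / real (length \<nu>)"

text \<open>A list stands for a finitely supported probability measure with rational weights,
  repetitions being counted; \<open>conv\<close> is convolution. The empty list has average 0
  (division by zero), so linearity of \<open>avg\<close> needs no side condition.\<close>

definition conv :: "'g::ab_group_add list \<Rightarrow> 'g list \<Rightarrow> 'g list" where
  "conv \<mu> \<nu> = concat (map (\<lambda>h. map ((+) h) \<nu>) \<mu>)"

lemma avg_map: "avg (map f \<nu>) F = avg \<nu> (\<lambda>t. F (f t))"
  by (simp add: avg_def comp_def)

lemma avg_add: "avg \<nu> (\<lambda>t. F t + G t) = avg \<nu> F + avg \<nu> G"
  by (simp add: avg_def sum_list_addf add_divide_distrib)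

lemma avg_cmult: "avg \<nu> (\<lambda>t. c * F t) = c * avg \<nu> F"
  by (simp add: avg_def sum_list_const_mult)

lemma avg_multc: "avg \<nu> (\<lambda>t. F t * c) = avg \<nu> F * c"
  using avg_cmult[of \<nu> c F] by (simp add: mult.commute)

lemma avg_diff: "avg \<nu> (\<lambda>t. F t - G t) = avg \<nu> F - avg \<nu> G"
  using avg_add[of \<nu> F "\<lambda>t. (-1) * G t"] avg_cmult[of \<nu> "-1" G] by simp

lemma avg_const: "\<nu> \<noteq> [] \<Longrightarrow> avg \<nu> (\<lambda>t. c) = c"
  by (simp add: avg_def sum_list_triv)

lemma avg_mono: "(\<And>t. t \<in> set \<nu> \<Longrightarrow> F t \<le> G t) \<Longrightarrow> avg \<nu> F \<le> avg \<nu> G"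
  unfolding avg_def by (intro divide_right_mono sum_list_mono) auto

lemma avg_le:
  assumes "\<nu> \<noteq> []" "\<And>t. t \<in> set \<nu> \<Longrightarrow> F t \<le> c" shows "avg \<nu> F \<le> c"
  using avg_mono[of \<nu> F "\<lambda>_. c"] assms by (simp add: avg_const)

lemma avg_ge:
  assumes "\<nu> \<noteq> []" "\<And>t. t \<in> set \<nu> \<Longrightarrow> c \<le> F t" shows "c \<le> avg \<nu> F"
  using avg_mono[of \<nu> "\<lambda>_. c" F] assms by (simp add: avg_const)

lemma avg_abs_le:
  assumes "\<nu> \<noteq> []" "\<And>t. t \<in> set \<nu> \<Longrightarrow> \<bar>F t\<bar> \<le> c" shows "\<bar>avg \<nu> F\<bar> \<le> c"
  using avg_le[of \<nu> F c] avg_ge[of \<nu> "-c" F] assms by (force simp: abs_le_iff)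

lemma avg_abs: "\<bar>avg \<nu> F\<bar> \<le> avg \<nu> (\<lambda>t. \<bar>F t\<bar>)"
proof -
  have "avg \<nu> F \<le> avg \<nu> (\<lambda>t. \<bar>F t\<bar>)" "avg \<nu> (\<lambda>t. (-1) * F t) \<le> avg \<nu> (\<lambda>t. \<bar>F t\<bar>)"
    by (auto intro: avg_mono)
  then show ?thesis unfolding avg_cmult by (simp add: abs_le_iff)
qed

lemma avg_sum: "avg \<nu> (\<lambda>t. \<Sum>i\<in>I. F i t) = (\<Sum>i\<in>I. avg \<nu> (F i))"
proof (induction I rule: infinite_finite_induct)
  case (insert i I) then show ?case by (simp add: avg_add)
qed (simp_all add: avg_def sum_list_0)

lemma avg_swap: "avg \<mu> (\<lambda>h. avg \<nu> (\<lambda>t. F h t)) = avg \<nu> (\<lambda>t. avg \<mu> (\<lambda>h. F h t))"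
proof -
  have "(\<Sum>h\<leftarrow>\<mu>. avg \<nu> (\<lambda>t. F h t)) = avg \<nu> (\<lambda>t. \<Sum>h\<leftarrow>\<mu>. F h t)"
    by (induction \<mu>) (simp_all add: avg_add, simp add: avg_def)
  then show ?thesis
    using avg_multc[of \<nu> "\<lambda>t. \<Sum>h\<leftarrow>\<mu>. F h t" "1 / real (length \<mu>)"] by (simp add: avg_def)
qed

lemma sum_list_conv_double:
  "(\<Sum>u\<leftarrow>conv \<mu> \<nu>. F u) = (\<Sum>h\<leftarrow>\<mu>. \<Sum>t\<leftarrow>\<nu>. F (h + t) :: real)"
  by (induction \<mu>) (auto simp: conv_def comp_def)

lemma length_conv: "length (conv \<mu> \<nu>) = length \<mu> * length \<nu>"
  by (induction \<mu>) (auto simp: conv_def)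

lemma conv_Nil_iff: "conv \<mu> \<nu> \<noteq> [] \<longleftrightarrow> \<mu> \<noteq> [] \<and> \<nu> \<noteq> []"
  by (metis length_0_conv length_conv mult_eq_0_iff)

lemma avg_conv: "avg (conv \<mu> \<nu>) F = avg \<mu> (\<lambda>h. avg \<nu> (\<lambda>t. F (h + t)))"
  by (simp add: avg_def sum_list_conv_double length_conv divide_inverse
      sum_list_mult_const)

lemma avg_append_same_length:
  "length \<mu> = length \<nu> \<Longrightarrow> avg (\<mu> @ \<nu>) F = (avg \<mu> F + avg \<nu> F) / 2"
  by (simp add: avg_def add_divide_distrib)

lemma avg_square_le: "(avg \<nu> F)\<^sup>2 \<le> avg \<nu> (\<lambda>t. (F t)\<^sup>2)"
proof (cases "\<nu> = []")
  case False
  have "0 \<le> avg \<nu> (\<lambda>t. (F t - avg \<nu> F)\<^sup>2)" by (rule avg_ge[OF False]) simp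
  also have "\<dots> = avg \<nu> (\<lambda>t. (F t)\<^sup>2 - 2 * avg \<nu> F * F t + (avg \<nu> F)\<^sup>2)"
    by (simp add: power2_diff algebra_simps)
  also have "\<dots> = avg \<nu> (\<lambda>t. (F t)\<^sup>2) - 2 * avg \<nu> F * avg \<nu> F + (avg \<nu> F)\<^sup>2"
    by (simp only: avg_add avg_diff avg_cmult avg_const[OF False])
  finally show ?thesis by (simp add: power2_eq_square)
qed (simp add: avg_def)

text \<open>The bound is uniform in the translate \<open>x\<close>, so averaging over a further list
  cannot spoil it.\<close>

definition mean_zero :: "('g::ab_group_add \<Rightarrow> real) \<Rightarrow> bool" where
  "mean_zero F \<longleftrightarrow> (\<forall>\<epsilon>>0. \<exists>\<nu>. \<nu> \<noteq> [] \<and> (\<forall>x. \<bar>avg \<nu> (\<lambda>t. F (x + t))\<bar> \<le> \<epsilon>))"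

text \<open>The convolution of the two lists serves both functions: one factor does the cancelling,
  the other merely averages a bound that holds at every translate. Exchanging the factors uses
  commutativity.\<close>

lemma mean_zero_add:
  assumes "mean_zero F" "mean_zero G"
  shows "mean_zero (\<lambda>g. F g + G g)"
  unfolding mean_zero_def
proof (intro allI impI)
  fix \<epsilon> :: real assume "\<epsilon> > 0"
  then have "\<epsilon> / 2 > 0" by simp
  then obtain \<mu> \<nu> where \<mu>: "\<mu> \<noteq> []" "\<And>x. \<bar>avg \<mu> (\<lambda>t. F (x + t))\<bar> \<le> \<epsilon> / 2"
    and \<nu>: "\<nu> \<noteq> []" "\<And>x. \<bar>avg \<nu> (\<lambda>t. G (x + t))\<bar> \<le> \<epsilon> / 2"
    using assms unfolding mean_zero_def by meson
  have "\<bar>avg (conv \<mu> \<nu>) (\<lambda>t. F (x + t) + G (x + t))\<bar> \<le> \<epsilon>" for x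
  proof -
    have "avg (conv \<mu> \<nu>) (\<lambda>t. F (x + t)) = avg \<nu> (\<lambda>t. avg \<mu> (\<lambda>h. F ((x + t) + h)))"
      unfolding avg_conv by (subst avg_swap) (simp add: ac_simps)
    then have 1: "\<bar>avg (conv \<mu> \<nu>) (\<lambda>t. F (x + t))\<bar> \<le> \<epsilon> / 2"
      using \<mu>(2) by (simp only: avg_abs_le[OF \<nu>(1)])
    have "avg (conv \<mu> \<nu>) (\<lambda>t. G (x + t)) = avg \<mu> (\<lambda>h. avg \<nu> (\<lambda>t. G ((x + h) + t)))"
      unfolding avg_conv by (simp add: ac_simps)
    then have "\<bar>avg (conv \<mu> \<nu>) (\<lambda>t. G (x + t))\<bar> \<le> \<epsilon> / 2"
      using \<nu>(2) by (simp only: avg_abs_le[OF \<mu>(1)])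
    with 1 show ?thesis by (simp add: avg_add)
  qed
  then show "\<exists>\<nu>. \<nu> \<noteq> [] \<and> (\<forall>x. \<bar>avg \<nu> (\<lambda>t. F (x + t) + G (x + t))\<bar> \<le> \<epsilon>)"
    using \<mu>(1) \<nu>(1) conv_Nil_iff by blast
qed

lemma mean_zero_const_0: "mean_zero (\<lambda>g. 0)"
  unfolding mean_zero_def by (auto intro!: exI[of _ "[0]"] simp: avg_def)

lemma mean_zero_cmult:
  assumes "mean_zero F" shows "mean_zero (\<lambda>g. c * F g)"
  unfolding mean_zero_def
proof (intro allI impI)
  fix \<epsilon> :: real assume "\<epsilon> > 0"
  then have "\<epsilon> / (\<bar>c\<bar> + 1) > 0" by simp
  then obtain \<nu> where \<nu>: "\<nu> \<noteq> []" "\<And>x. \<bar>avg \<nu> (\<lambda>t. F (x + t))\<bar> \<le> \<epsilon> / (\<bar>c\<bar> + 1)"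
    using assms unfolding mean_zero_def by meson
  have "\<bar>avg \<nu> (\<lambda>t. c * F (x + t))\<bar> \<le> \<epsilon>" for x
  proof -
    have "\<bar>avg \<nu> (\<lambda>t. c * F (x + t))\<bar> \<le> \<bar>c\<bar> * (\<epsilon> / (\<bar>c\<bar> + 1))"
      unfolding avg_cmult abs_mult by (intro mult_left_mono \<nu>(2)) auto
    also have "\<dots> \<le> \<epsilon>" using \<open>\<epsilon> > 0\<close> by (simp add: field_simps)
    finally show ?thesis .
  qed
  then show "\<exists>\<nu>. \<nu> \<noteq> [] \<and> (\<forall>x. \<bar>avg \<nu> (\<lambda>t. c * F (x + t))\<bar> \<le> \<epsilon>)" using \<nu>(1) by blast
qed

lemma mean_zero_avg:
  assumes "\<And>i. i \<in> set xs \<Longrightarrow> mean_zero (F i)"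
  shows "mean_zero (\<lambda>g. avg xs (\<lambda>i. F i g))"
proof -
  have "mean_zero (\<lambda>g. \<Sum>i\<leftarrow>xs. F i g)" using assms
    by (induction xs) (auto simp: mean_zero_const_0 intro: mean_zero_add)
  from mean_zero_cmult[OF this, of "1 / real (length xs)"] show ?thesis
    by (simp add: avg_def)
qed

lemma avg_half: "avg \<nu> (\<lambda>t. F t / 2) = avg \<nu> F / 2"
  using avg_multc[of \<nu> F "1 / 2"] by simp

text \<open>A near-minimiser of \<open>\<nu> \<mapsto> avg \<nu> (\<lambda>t. avg \<nu> (\<lambda>s. \<kappa> (t - s)))\<close> is almost invariant, because
  concatenating \<open>\<nu>\<close> with its translate by \<open>h\<close> cannot decrease this quantity much.\<close>
lemma almost_invariant_list:
  fixes \<kappa> :: "'g::ab_group_add \<Rightarrow> real"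
  assumes bdd: "\<And>g. \<bar>\<kappa> g\<bar> \<le> C" and even: "\<And>g. \<kappa> (- g) = \<kappa> g" and "\<epsilon> > 0"
  shows "\<exists>\<nu>. \<nu> \<noteq> [] \<and> (\<forall>h. avg \<nu> (\<lambda>t. avg \<nu> (\<lambda>s. \<kappa> (t - s)))
            - avg \<nu> (\<lambda>t. avg \<nu> (\<lambda>s. \<kappa> (h + t - s))) \<le> \<epsilon>)"
proof -
  define Q where "Q \<nu> = avg \<nu> (\<lambda>t. avg \<nu> (\<lambda>s. \<kappa> (t - s)))" for \<nu>
  define q where "q = Inf (Q ` {\<nu>. \<nu> \<noteq> []})"
  have lb: "- C \<le> Q \<nu>" if "\<nu> \<noteq> []" for \<nu>
    unfolding Q_def using that bdd by (intro avg_ge) (auto simp: abs_le_iff minus_le_iff)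
  have bb: "bdd_below (Q ` {\<nu>. \<nu> \<noteq> []})" using lb by (auto intro!: bdd_belowI)
  have "\<exists>y\<in>Q ` {\<nu>. \<nu> \<noteq> []}. y < q + \<epsilon> / 2"
    unfolding q_def using \<open>\<epsilon> > 0\<close> bb by (subst cInf_less_iff[symmetric]) auto
  then obtain \<nu> where \<nu>: "\<nu> \<noteq> []" "Q \<nu> < q + \<epsilon> / 2" by auto
  have "Q \<nu> - avg \<nu> (\<lambda>t. avg \<nu> (\<lambda>s. \<kappa> (h + t - s))) \<le> \<epsilon>" for h
  proof -
    let ?\<nu> = "\<nu> @ map ((+) h) \<nu>"
    let ?R = "avg \<nu> (\<lambda>t. avg \<nu> (\<lambda>s. \<kappa> (h + t - s)))"
    have e: "\<kappa> (t - (h + s)) = \<kappa> (h + s - t)" for t s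
      using even[of "h + s - t"] by (simp add: algebra_simps)
    have "q \<le> Q ?\<nu>" unfolding q_def using \<nu>(1) by (intro cInf_lower bb) auto
    \<comment> \<open>Of the four blocks the two diagonal ones equal \<open>Q \<nu>\<close>, because
      \<open>h\<close> cancels in differences, and evenness makes the other two equal. Hence
      \<open>Q \<nu> + ?R \<ge> 2 * q > 2 * Q \<nu> - \<epsilon>\<close>.\<close>
    also have "Q ?\<nu> = (2 * Q \<nu> + ?R + avg \<nu> (\<lambda>t. avg \<nu> (\<lambda>s. \<kappa> (t - (h + s))))) / 4"
      unfolding Q_def
      by (simp add: avg_append_same_length avg_map avg_add add_divide_distrib avg_half)
    also have "avg \<nu> (\<lambda>t. avg \<nu> (\<lambda>s. \<kappa> (t - (h + s)))) = ?R"
      unfolding e by (rule avg_swap)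
    finally show ?thesis using \<nu>(2) by (simp add: field_simps)
  qed
  then show ?thesis using \<nu>(1) unfolding Q_def by blast
qed

section \<open>Positive semidefinite kernels and their Cauchy-Schwarz inequality\<close>

text \<open>Coefficients and indices are packed into a list so that indices may repeat.\<close>
definition psd :: "('i \<Rightarrow> 'i \<Rightarrow> real) \<Rightarrow> bool" where
  "psd k \<longleftrightarrow> (\<forall>xs. 0 \<le> (\<Sum>(c, i)\<leftarrow>xs. \<Sum>(d, j)\<leftarrow>xs. c * d * k i j))"

lemma psd_add:
  assumes "psd k" "psd l" shows "psd (\<lambda>i j. k i j + l i j)"
  using assms unfolding psd_def
  by (auto simp: distrib_left sum_list_addf case_prod_unfold intro!: add_nonneg_nonneg)

lemma psd_one: "psd (\<lambda>i j. 1)"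
  unfolding psd_def
proof
  fix xs :: "(real \<times> 'i) list"
  have "(\<Sum>(c, i)\<leftarrow>xs. \<Sum>(d, j)\<leftarrow>xs. c * d * 1) = (\<Sum>(c, i)\<leftarrow>xs. c)\<^sup>2"
    by (simp add: case_prod_unfold sum_list_const_mult sum_list_mult_const power2_eq_square)
  then show "0 \<le> (\<Sum>(c, i)\<leftarrow>xs. \<Sum>(d, j)\<leftarrow>xs. c * d * 1)" by simp
qed

lemma psd_pullback:
  assumes "psd k" shows "psd (\<lambda>i j. k (p i) (p j))"
  unfolding psd_def
proof
  fix xs
  show "0 \<le> (\<Sum>(c, i)\<leftarrow>xs. \<Sum>(d, j)\<leftarrow>xs. c * d * k (p i) (p j))"
    using assms[unfolded psd_def, rule_format, of "map (\<lambda>(c, i). (c, p i)) xs"]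
    by (simp add: comp_def case_prod_unfold)
qed

text \<open>The discriminant of a nonnegative quadratic. The sign of \<open>c\<close> is derived
  rather than assumed, so null vectors need no separate treatment later.\<close>

lemma quadratic_nonneg_imp:
  fixes a b c :: real
  assumes "\<And>l. 0 \<le> a + 2 * l * b + l\<^sup>2 * c"
  shows "b\<^sup>2 \<le> a * c"
proof (cases "c = 0")
  case True
  have "b = 0"
  proof (rule ccontr)
    assume "b \<noteq> 0"
    \<comment> \<open>At this \<open>l\<close> the expression equals -1.\<close>
    then show False using assms[of "- (a + 1) / (2 * b)"] True by (simp add: field_simps)
  qed
  then show ?thesis using True by simp
next
  case False
  have c: "c > 0"
  proof (rule ccontr)
    assume "\<not> c > 0"
    with False have "c < 0" by simp
    define l where "l = (\<bar>a\<bar> + 2 * \<bar>b\<bar> + 1) / (-c) + 1"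
    have l: "l \<ge> 1" "l * (-c) \<ge> \<bar>a\<bar> + 2 * \<bar>b\<bar> + 1"
      using \<open>c < 0\<close> by (auto simp: l_def field_simps)
    have "l * (l * (-c)) \<ge> l * (\<bar>a\<bar> + 2 * \<bar>b\<bar> + 1)" using l by (intro mult_left_mono) auto
    moreover have "l * (\<bar>a\<bar> + 1) \<ge> \<bar>a\<bar> + 1"
      using l(1) mult_right_mono[of 1 l "\<bar>a\<bar> + 1"] by simp
    moreover have "l * b \<le> l * \<bar>b\<bar>" using l(1) by (intro mult_left_mono) auto
    ultimately show False using assms[of l] by (simp add: power2_eq_square algebra_simps)
  qed
  have "a + 2 * (-b/c) * b + (-b/c)\<^sup>2 * c = a - b\<^sup>2 / c"
    using c by (simp add: power2_eq_square field_simps)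
  then have "0 \<le> a - b\<^sup>2 / c" using assms[of "-b/c"] by simp
  with c show ?thesis by (simp add: pos_divide_le_eq)
qed

text \<open>Adjoining index \<open>j\<close> with a free coefficient \<open>l\<close> makes the form
  a nonnegative quadratic in \<open>l\<close>. Different kernels turn this into Cauchy-Schwarz for
  \<open>ip\<close>, the Hilbert-Schmidt bound and van der Corput's inequality.\<close>

lemma psd_Cauchy_Schwarz:
  assumes psd: "psd k" and sym: "\<And>i j. k i j = k j i"
  shows "(\<Sum>(c, i)\<leftarrow>xs. c * k i j)\<^sup>2 \<le> (\<Sum>(c, i)\<leftarrow>xs. \<Sum>(d, i')\<leftarrow>xs. c * d * k i i') * k j j"
proof (rule quadratic_nonneg_imp)
  fix l
  have "0 \<le> (\<Sum>(c, i)\<leftarrow>(l, j) # xs. \<Sum>(d, i')\<leftarrow>(l, j) # xs. c * d * k i i')"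
    using psd unfolding psd_def by blast
  also have "\<dots> = l * l * k j j + (\<Sum>(d, i')\<leftarrow>xs. l * d * k j i')
      + (\<Sum>(c, i)\<leftarrow>xs. c * l * k i j) + (\<Sum>(c, i)\<leftarrow>xs. \<Sum>(d, i')\<leftarrow>xs. c * d * k i i')"
    by (simp add: case_prod_unfold sum_list_addf)
  also have "(\<Sum>(d, i')\<leftarrow>xs. l * d * k j i') = l * (\<Sum>(c, i)\<leftarrow>xs. c * k i j)"
    by (simp add: sum_list_const_mult[symmetric] case_prod_unfold mult.assoc sym[of j])
  also have "(\<Sum>(c, i)\<leftarrow>xs. c * l * k i j) = l * (\<Sum>(c, i)\<leftarrow>xs. c * k i j)"
    by (simp add: sum_list_const_mult[symmetric] case_prod_unfold ac_simps)
  finally show "0 \<le> (\<Sum>(c, i)\<leftarrow>xs. \<Sum>(d, i')\<leftarrow>xs. c * d * k i i')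
      + 2 * l * (\<Sum>(c, i)\<leftarrow>xs. c * k i j) + l\<^sup>2 * k j j"
    by (simp add: power2_eq_square algebra_simps)
qed

section \<open>Bounded functions with the \<open>L\<^sup>2\<close> seminorm\<close>

context prob_space
begin

text \<open>Bounded functions are closed under products, and working with functions instead of
  classes modulo null sets allows pointwise composition with \<open>T g\<close>.\<close>

definition bm :: "('a \<Rightarrow> real) \<Rightarrow> bool" where
  "bm f \<longleftrightarrow> f \<in> borel_measurable M \<and> (\<exists>C. \<forall>x\<in>space M. \<bar>f x\<bar> \<le> C)"

definition ip :: "('a \<Rightarrow> real) \<Rightarrow> ('a \<Rightarrow> real) \<Rightarrow> real" where
  "ip f g = (\<integral>x. f x * g x \<partial>M)"

definition nrm :: "('a \<Rightarrow> real) \<Rightarrow> real" where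
  "nrm f = sqrt (ip f f)"

lemma bmI: "f \<in> borel_measurable M \<Longrightarrow> (\<And>x. x \<in> space M \<Longrightarrow> \<bar>f x\<bar> \<le> C) \<Longrightarrow> bm f"
  unfolding bm_def by blast

lemma bm_measurable: "bm f \<Longrightarrow> f \<in> borel_measurable M"
  unfolding bm_def by blast

lemma bm_bound: assumes "bm f" shows "\<exists>C\<ge>0. \<forall>x\<in>space M. \<bar>f x\<bar> \<le> C"
proof -
  obtain C where "\<forall>x\<in>space M. \<bar>f x\<bar> \<le> C" using assms unfolding bm_def by blast
  then have "\<forall>x\<in>space M. \<bar>f x\<bar> \<le> max C 0" by (simp add: le_max_iff_disj)
  then show ?thesis by (intro exI[of _ "max C 0"]) simp
qed

lemma bm_const: "bm (\<lambda>x. c)"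
  by (rule bmI[of _ "\<bar>c\<bar>"]) auto

lemma bm_add: assumes "bm f" "bm g" shows "bm (\<lambda>x. f x + g x)"
proof -
  obtain C where C: "\<And>x. x \<in> space M \<Longrightarrow> \<bar>f x\<bar> \<le> C" using bm_bound[OF assms(1)] by blast
  obtain D where D: "\<And>x. x \<in> space M \<Longrightarrow> \<bar>g x\<bar> \<le> D" using bm_bound[OF assms(2)] by blast
  have "\<bar>f x + g x\<bar> \<le> C + D" if "x \<in> space M" for x using C[OF that] D[OF that] by linarith
  then show ?thesis using assms by (intro bmI[of _ "C + D"]) (auto intro: borel_measurable_add bm_measurable)
qed

lemma bm_mult: assumes "bm f" "bm g" shows "bm (\<lambda>x. f x * g x)"
proof -
  obtain C where C: "C \<ge> 0" "\<And>x. x \<in> space M \<Longrightarrow> \<bar>f x\<bar> \<le> C" using bm_bound[OF assms(1)] by blast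
  obtain D where D: "\<And>x. x \<in> space M \<Longrightarrow> \<bar>g x\<bar> \<le> D" using bm_bound[OF assms(2)] by blast
  have "\<bar>f x * g x\<bar> \<le> C * D" if "x \<in> space M" for x
    unfolding abs_mult using C D that by (intro mult_mono) auto
  then show ?thesis using assms by (intro bmI[of _ "C * D"]) (auto intro: borel_measurable_times bm_measurable)
qed

lemma bm_cmult: "bm f \<Longrightarrow> bm (\<lambda>x. c * f x)"
  by (intro bm_mult bm_const)

lemma bm_diff: assumes "bm f" "bm g" shows "bm (\<lambda>x. f x - g x)"
  using bm_add[OF assms(1) bm_cmult[OF assms(2), of "-1"]] by simp

lemma bm_sum_list: "(\<And>i. i \<in> set xs \<Longrightarrow> bm (f i)) \<Longrightarrow> bm (\<lambda>x. \<Sum>i\<leftarrow>xs. f i x)"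
  by (induction xs) (auto intro: bm_add bm_const)

lemma bm_avg: "(\<And>i. i \<in> set xs \<Longrightarrow> bm (f i)) \<Longrightarrow> bm (\<lambda>x. avg xs (\<lambda>i. f i x))"
  using bm_cmult[OF bm_sum_list[of xs f], of "1 / real (length xs)"] by (simp add: avg_def)

lemma bm_indicator: "A \<in> sets M \<Longrightarrow> bm (indicat_real A)"
  by (rule bmI[of _ 1]) (auto simp: indicator_def)

lemmas bm_intros = bm_const bm_add bm_mult bm_diff bm_avg

lemma bm_integrable: assumes "bm f" shows "integrable M f"
proof -
  obtain C where "\<And>x. x \<in> space M \<Longrightarrow> \<bar>f x\<bar> \<le> C" using bm_bound[OF assms] by blast
  then show ?thesis using assms
    by (intro integrable_const_bound[of _ C]) (auto simp: bm_measurable)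
qed

lemma ip_integrable: "bm f \<Longrightarrow> bm g \<Longrightarrow> integrable M (\<lambda>x. f x * g x)"
  by (intro bm_integrable bm_mult)

lemma ip_commute: "ip f g = ip g f"
  by (simp add: ip_def mult.commute)

lemma ip_add_left: "bm f \<Longrightarrow> bm g \<Longrightarrow> bm h \<Longrightarrow> ip (\<lambda>x. f x + g x) h = ip f h + ip g h"
  by (simp add: ip_def distrib_right ip_integrable)

lemma ip_cmult_left: "ip (\<lambda>x. c * f x) g = c * ip f g"
  by (simp add: ip_def mult.assoc)

lemma ip_diff_left: "bm f \<Longrightarrow> bm g \<Longrightarrow> bm h \<Longrightarrow> ip (\<lambda>x. f x - g x) h = ip f h - ip g h"
  by (simp add: ip_def left_diff_distrib ip_integrable)

lemma ip_add_right: "bm f \<Longrightarrow> bm g \<Longrightarrow> bm h \<Longrightarrow> ip h (\<lambda>x. f x + g x) = ip h f + ip h g"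
  using ip_add_left[of f g h] by (simp add: ip_commute)

lemma ip_cmult_right: "ip g (\<lambda>x. c * f x) = c * ip g f"
  using ip_cmult_left[of c f g] by (simp add: ip_commute)

lemma ip_diff_right: "bm f \<Longrightarrow> bm g \<Longrightarrow> bm h \<Longrightarrow> ip h (\<lambda>x. f x - g x) = ip h f - ip h g"
  using ip_diff_left[of f g h] by (simp add: ip_commute)

lemma integrable_sum_list:
  fixes f :: "'b \<Rightarrow> 'a \<Rightarrow> real"
  shows "(\<And>i. i \<in> set xs \<Longrightarrow> integrable M (f i)) \<Longrightarrow> integrable M (\<lambda>x. \<Sum>i\<leftarrow>xs. f i x)"
  by (induction xs) auto

lemma integral_sum_list:
  fixes f :: "'b \<Rightarrow> 'a \<Rightarrow> real"
  shows "(\<And>i. i \<in> set xs \<Longrightarrow> integrable M (f i)) \<Longrightarrow>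
    (\<integral>x. (\<Sum>i\<leftarrow>xs. f i x) \<partial>M) = (\<Sum>i\<leftarrow>xs. \<integral>x. f i x \<partial>M)"
  by (induction xs) (auto simp: integrable_sum_list)

lemma integral_avg:
  "(\<And>i. i \<in> set xs \<Longrightarrow> bm (f i)) \<Longrightarrow> (\<integral>x. avg xs (\<lambda>i. f i x) \<partial>M) = avg xs (\<lambda>i. \<integral>x. f i x \<partial>M)"
  using integral_sum_list[of xs f] by (simp add: avg_def bm_integrable)

lemma ip_avg_left:
  assumes "\<And>i. i \<in> set xs \<Longrightarrow> bm (f i)" "bm g"
  shows "ip (\<lambda>x. avg xs (\<lambda>i. f i x)) g = avg xs (\<lambda>i. ip (f i) g)"
  unfolding ip_def using integral_avg[of xs "\<lambda>i x. f i x * g x"] assms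
  by (simp add: avg_multc bm_mult)

lemma ip_cong:
  "(\<And>x. x \<in> space M \<Longrightarrow> f x = f' x) \<Longrightarrow> (\<And>x. x \<in> space M \<Longrightarrow> g x = g' x) \<Longrightarrow> ip f g = ip f' g'"
  unfolding ip_def by (intro Bochner_Integration.integral_cong) auto

lemma ip_nonneg: "0 \<le> ip f f"
  unfolding ip_def by simp

lemma nrm_nonneg: "0 \<le> nrm f" by (simp add: nrm_def ip_nonneg)

lemma nrm_square: "(nrm f)\<^sup>2 = ip f f" by (simp add: nrm_def ip_nonneg)

lemma nrm_cong: "(\<And>x. x \<in> space M \<Longrightarrow> f x = g x) \<Longrightarrow> nrm f = nrm g"
  unfolding nrm_def by (metis ip_cong)

lemma ip_mono:
  assumes "bm f" "bm g" "\<And>x. x \<in> space M \<Longrightarrow> \<bar>f x\<bar> \<le> \<bar>g x\<bar>" shows "ip f f \<le> ip g g"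
  unfolding ip_def
proof (rule integral_mono)
  show "f x * f x \<le> g x * g x" if "x \<in> space M" for x
    using assms(3)[OF that] abs_le_square_iff[of "f x" "g x"] by (simp add: power2_eq_square)
qed (use assms in \<open>auto intro: ip_integrable\<close>)

lemma nrm_mono:
  assumes "bm f" "bm g" "\<And>x. x \<in> space M \<Longrightarrow> \<bar>f x\<bar> \<le> \<bar>g x\<bar>" shows "nrm f \<le> nrm g"
  unfolding nrm_def using ip_mono[OF assms] by simp

text \<open>Schur's product theorem for a Gram kernel: at each point \<open>x\<close> the integrand
  is the quadratic form of \<open>k\<close> with coefficients \<open>c * Y i x\<close>, and
  integration preserves nonnegativity.\<close>

lemma psd_times_ip:
  assumes "psd k" "\<And>i. bm (Y i)"
  shows "psd (\<lambda>i j. k i j * ip (Y i) (Y j))"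
  unfolding psd_def
proof
  fix xs
  have "0 \<le> (\<integral>x. (\<Sum>(c, i)\<leftarrow>xs. \<Sum>(d, j)\<leftarrow>xs. (c * Y i x) * (d * Y j x) * k i j) \<partial>M)"
  proof (rule Bochner_Integration.integral_nonneg)
    fix x
    show "0 \<le> (\<Sum>(c, i)\<leftarrow>xs. \<Sum>(d, j)\<leftarrow>xs. (c * Y i x) * (d * Y j x) * k i j)"
      using assms(1)[unfolded psd_def, rule_format, of "map (\<lambda>(c, i). (c * Y i x, i)) xs"]
      by (simp add: comp_def case_prod_unfold)
  qed
  also have "\<dots> = (\<integral>x. (\<Sum>(c, i)\<leftarrow>xs. \<Sum>(d, j)\<leftarrow>xs. (c * d * k i j) * (Y i x * Y j x)) \<partial>M)"
    by (intro Bochner_Integration.integral_cong refl) (simp add: ac_simps)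
  also have "\<dots> = (\<Sum>(c, i)\<leftarrow>xs. \<integral>x. (\<Sum>(d, j)\<leftarrow>xs. (c * d * k i j) * (Y i x * Y j x)) \<partial>M)"
    unfolding case_prod_unfold
    by (intro integral_sum_list integrable_sum_list integrable_mult_right ip_integrable assms)
  also have "\<dots> = (\<Sum>(c, i)\<leftarrow>xs. \<Sum>(d, j)\<leftarrow>xs. \<integral>x. (c * d * k i j) * (Y i x * Y j x) \<partial>M)"
    unfolding case_prod_unfold
    by (simp only: integral_sum_list integrable_mult_right ip_integrable assms)
  also have "\<dots> = (\<Sum>(c, i)\<leftarrow>xs. \<Sum>(d, j)\<leftarrow>xs. (c * d * k i j) * ip (Y i) (Y j))"
    by (simp add: ip_def)
  finally show "0 \<le> (\<Sum>(c, i)\<leftarrow>xs. \<Sum>(d, j)\<leftarrow>xs. c * d * (k i j * ip (Y i) (Y j)))"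
    by (simp add: ac_simps)
qed

lemma psd_ip: "(\<And>i. bm (Y i)) \<Longrightarrow> psd (\<lambda>i j. ip (Y i) (Y j))"
  using psd_times_ip[OF psd_one, of Y] by simp

lemma ip_Cauchy_Schwarz:
  assumes "bm f" "bm g" shows "(ip f g)\<^sup>2 \<le> ip f f * ip g g"
proof -
  have "psd (\<lambda>i j. ip (if i then f else g) (if j then f else g))"
    using assms by (intro psd_ip) auto
  from psd_Cauchy_Schwarz[OF this ip_commute, where xs = "[(1, True)]" and j = False] show ?thesis by simp
qed

lemma ip_le_nrm: assumes "bm f" "bm g" shows "\<bar>ip f g\<bar> \<le> nrm f * nrm g"
  using real_sqrt_le_mono[OF ip_Cauchy_Schwarz[OF assms]]
  by (simp add: nrm_def real_sqrt_mult)

lemma nrm_triangle: assumes "bm f" "bm g" shows "nrm (\<lambda>x. f x + g x) \<le> nrm f + nrm g"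
proof (rule power2_le_imp_le)
  have "(nrm (\<lambda>x. f x + g x))\<^sup>2 = ip f f + 2 * ip f g + ip g g"
    unfolding nrm_square using assms
    by (simp add: ip_add_left ip_add_right bm_add ip_commute[of g f])
  also have "\<dots> \<le> (nrm f)\<^sup>2 + 2 * (nrm f * nrm g) + (nrm g)\<^sup>2"
    using ip_le_nrm[OF assms] by (simp add: nrm_square abs_le_iff)
  finally show "(nrm (\<lambda>x. f x + g x))\<^sup>2 \<le> (nrm f + nrm g)\<^sup>2"
    by (simp add: power2_sum)
qed (simp add: nrm_nonneg)

lemma nrm_triangle_diff:
  assumes "bm f" "bm g" "bm h"
  shows "nrm (\<lambda>x. f x - h x) \<le> nrm (\<lambda>x. f x - g x) + nrm (\<lambda>x. g x - h x)"
  using nrm_triangle[OF bm_diff[OF assms(1,2)] bm_diff[OF assms(2,3)]] by simp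

lemma nrm_minus_commute: "nrm (\<lambda>x. f x - g x) = nrm (\<lambda>x. g x - f x)"
proof -
  have "(f x - g x) * (f x - g x) = (g x - f x) * (g x - f x)" for x by algebra
  then show ?thesis by (simp add: nrm_def ip_def)
qed

lemma nrm_cmult: "nrm (\<lambda>x. c * f x) = \<bar>c\<bar> * nrm f"
  by (simp add: nrm_def ip_cmult_left ip_cmult_right real_sqrt_mult mult.assoc[symmetric])

lemma nrm_le_bound:
  assumes "bm f" "\<And>x. x \<in> space M \<Longrightarrow> \<bar>f x\<bar> \<le> C" "C \<ge> 0" shows "nrm f \<le> C"
proof -
  have "nrm f \<le> nrm (\<lambda>x. C)" using assms by (intro nrm_mono bm_const) auto
  also have "\<dots> = C" using \<open>C \<ge> 0\<close> by (simp add: nrm_def ip_def prob_space)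
  finally show ?thesis .
qed

lemma nrm_avg_diff_le:
  assumes "\<mu> \<noteq> []" "\<And>h. h \<in> set \<mu> \<Longrightarrow> bm (z h)" "bm c"
    and "\<And>h. h \<in> set \<mu> \<Longrightarrow> nrm (\<lambda>x. z h x - c x) \<le> \<epsilon>"
  shows "nrm (\<lambda>x. avg \<mu> (\<lambda>h. z h x) - c x) \<le> \<epsilon>"
proof (rule power2_le_imp_le)
  have \<epsilon>: "0 \<le> \<epsilon>"
    using assms(4)[of "hd \<mu>"] nrm_nonneg[of "\<lambda>x. z (hd \<mu>) x - c x"] assms(1) by simp
  then show "0 \<le> \<epsilon>" .
  have e: "avg \<mu> (\<lambda>h. z h x) - c x = avg \<mu> (\<lambda>h. z h x - c x)" for x
    by (simp add: avg_diff avg_const[OF assms(1)])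
  have b: "bm (\<lambda>x. (z h x - c x) * (z h x - c x))" if "h \<in> set \<mu>" for h
    using assms(2,3) that by (intro bm_intros) auto
  have "(nrm (\<lambda>x. avg \<mu> (\<lambda>h. z h x) - c x))\<^sup>2
      = (\<integral>x. avg \<mu> (\<lambda>h. z h x - c x) * avg \<mu> (\<lambda>h. z h x - c x) \<partial>M)"
    unfolding nrm_square ip_def e ..
  also have "\<dots> \<le> (\<integral>x. avg \<mu> (\<lambda>h. (z h x - c x) * (z h x - c x)) \<partial>M)"
  proof (rule integral_mono)
    show "integrable M (\<lambda>x. avg \<mu> (\<lambda>h. z h x - c x) * avg \<mu> (\<lambda>h. z h x - c x))"
      using assms(2,3) by (intro bm_integrable bm_intros) auto
    show "integrable M (\<lambda>x. avg \<mu> (\<lambda>h. (z h x - c x) * (z h x - c x)))"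
      using b by (intro bm_integrable bm_avg)
    show "avg \<mu> (\<lambda>h. z h x - c x) * avg \<mu> (\<lambda>h. z h x - c x)
        \<le> avg \<mu> (\<lambda>h. (z h x - c x) * (z h x - c x))" for x
      using avg_square_le[of \<mu> "\<lambda>h. z h x - c x"] by (simp add: power2_eq_square)
  qed
  also have "\<dots> = avg \<mu> (\<lambda>h. (nrm (\<lambda>x. z h x - c x))\<^sup>2)"
    unfolding nrm_square ip_def by (rule integral_avg) (rule b)
  also have "\<dots> \<le> \<epsilon>\<^sup>2"
    using assms(4) by (intro avg_le[OF assms(1)] power_mono nrm_nonneg)
  finally show "(nrm (\<lambda>x. avg \<mu> (\<lambda>h. z h x) - c x))\<^sup>2 \<le> \<epsilon>\<^sup>2" .
qed

text \<open>The geometric rate makes the sum of the increments integrable, so the sequence itself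
  converges almost everywhere, without passing to a subsequence; dominated convergence gives the
  limit in norm.\<close>

lemma bounded_L2_complete:
  assumes meas: "\<And>n. f n \<in> borel_measurable M"
    and bdd: "\<And>n x. x \<in> space M \<Longrightarrow> \<bar>f n x\<bar> \<le> C"
    and cauchy: "\<And>n. nrm (\<lambda>x. f (Suc n) x - f n x) \<le> (1/2) ^ n"
  obtains p where "p \<in> borel_measurable M" "\<And>x. x \<in> space M \<Longrightarrow> \<bar>p x\<bar> \<le> C"
    "(\<lambda>n. nrm (\<lambda>x. f n x - p x)) \<longlonglongrightarrow> 0"
proof -
  note [measurable] = meas
  have C: "C \<ge> 0" using not_empty bdd[of _ 0] by fastforce
  have bf: "bm (f n)" for n using meas bdd by (rule bmI)
  have L1: "(\<integral>\<^sup>+x. ennreal \<bar>f (Suc n) x - f n x\<bar> \<partial>M) \<le> ennreal ((1/2) ^ n)" for n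
  proof -
    have b: "bm (\<lambda>x. \<bar>f (Suc n) x - f n x\<bar>)"
      using bm_diff[OF bf bf, of "Suc n" n] unfolding bm_def by auto
    have "(\<integral>x. \<bar>f (Suc n) x - f n x\<bar> \<partial>M) = ip (\<lambda>x. \<bar>f (Suc n) x - f n x\<bar>) (\<lambda>x. 1)"
      by (simp add: ip_def)
    also have "\<dots> \<le> nrm (\<lambda>x. \<bar>f (Suc n) x - f n x\<bar>) * nrm (\<lambda>x. 1)"
      using ip_le_nrm[OF b bm_const, of 1] by (simp add: abs_le_iff)
    also have "\<dots> = nrm (\<lambda>x. f (Suc n) x - f n x)"
      by (simp add: nrm_def ip_def prob_space)
    also have "\<dots> \<le> (1/2) ^ n" by (rule cauchy)
    finally have *: "(\<integral>x. \<bar>f (Suc n) x - f n x\<bar> \<partial>M) \<le> (1/2) ^ n" .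
    have "(\<integral>\<^sup>+x. ennreal \<bar>f (Suc n) x - f n x\<bar> \<partial>M) = ennreal (\<integral>x. \<bar>f (Suc n) x - f n x\<bar> \<partial>M)"
      by (rule nn_integral_eq_integral) (auto intro: bm_integrable b)
    then show ?thesis using * by (simp add: ennreal_leI)
  qed
  have "(\<integral>\<^sup>+x. (\<Sum>n. ennreal \<bar>f (Suc n) x - f n x\<bar>) \<partial>M) = (\<Sum>n. \<integral>\<^sup>+x. ennreal \<bar>f (Suc n) x - f n x\<bar> \<partial>M)"
    by (rule nn_integral_suminf) measurable
  also have "\<dots> \<le> (\<Sum>n. ennreal ((1/2) ^ n))" by (intro suminf_le L1) auto
  also have "\<dots> < \<infinity>" by (simp add: suminf_ennreal2 less_top[symmetric])
  finally have "(\<integral>\<^sup>+x. (\<Sum>n. ennreal \<bar>f (Suc n) x - f n x\<bar>) \<partial>M) \<noteq> \<infinity>" by simp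
  then have "AE x in M. (\<Sum>n. ennreal \<bar>f (Suc n) x - f n x\<bar>) \<noteq> \<infinity>"
    by (intro nn_integral_PInf_AE) measurable
  then have conv: "AE x in M. convergent (\<lambda>n. f n x)"
  proof (rule AE_mp, intro AE_I2 impI)
    fix x assume "(\<Sum>n. ennreal \<bar>f (Suc n) x - f n x\<bar>) \<noteq> \<infinity>"
    then have "summable (\<lambda>n. \<bar>f (Suc n) x - f n x\<bar>)"
      by (intro summable_suminf_not_top) auto
    then have "summable (\<lambda>n. f (Suc n) x - f n x)" by (rule summable_rabs_cancel)
    then have "convergent (\<lambda>n. \<Sum>i<n. f (Suc i) x - f i x)" by (simp add: summable_iff_convergent)
    from convergent_add[OF this convergent_const[of "f 0 x"]]
    show "convergent (\<lambda>n. f n x)" by (simp add: sum_lessThan_telescope[of "\<lambda>n. f n x"])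
  qed
  \<comment> \<open>\<open>lim\<close> is arbitrary where the sequence diverges; clipping enforces
    the bound there and changes nothing elsewhere on the space.\<close>
  define p where "p x = max (- C) (min C (lim (\<lambda>n. f n x)))" for x
  have p_meas [measurable]: "p \<in> borel_measurable M"
    unfolding p_def by measurable
  have p_bdd: "\<bar>p x\<bar> \<le> C" for x using C unfolding p_def by auto
  have bp: "bm p" using p_meas p_bdd by (rule bmI)
  have lim: "AE x in M. (\<lambda>n. f n x) \<longlonglongrightarrow> p x"
    using conv
  proof (rule AE_mp, intro AE_I2 impI)
    fix x assume x: "x \<in> space M" "convergent (\<lambda>n. f n x)"
    then have *: "(\<lambda>n. f n x) \<longlonglongrightarrow> lim (\<lambda>n. f n x)" by (simp add: convergent_LIMSEQ_iff)
    have "lim (\<lambda>n. f n x) \<le> C" "- C \<le> lim (\<lambda>n. f n x)"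
      using bdd[OF x(1)] by (auto intro!: LIMSEQ_le_const[OF *] LIMSEQ_le_const2[OF *] simp: abs_le_iff minus_le_iff)
    then show "(\<lambda>n. f n x) \<longlonglongrightarrow> p x" using * by (simp add: p_def)
  qed
  have "(\<lambda>n. \<integral>x. (f n x - p x) * (f n x - p x) \<partial>M) \<longlonglongrightarrow> (\<integral>x. 0 \<partial>M)"
  proof (rule integral_dominated_convergence[where w = "\<lambda>_. (2 * C) * (2 * C)"])
    show "AE x in M. (\<lambda>n. (f n x - p x) * (f n x - p x)) \<longlonglongrightarrow> 0"
      using lim
    proof (rule AE_mp, intro AE_I2 impI)
      fix x assume "(\<lambda>n. f n x) \<longlonglongrightarrow> p x"
      then have "(\<lambda>n. (f n x - p x) * (f n x - p x)) \<longlonglongrightarrow> (p x - p x) * (p x - p x)"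
        by (intro tendsto_intros)
      then show "(\<lambda>n. (f n x - p x) * (f n x - p x)) \<longlonglongrightarrow> 0" by simp
    qed
    show "AE x in M. norm ((f n x - p x) * (f n x - p x)) \<le> (2 * C) * (2 * C)" for n
    proof (rule AE_I2)
      fix x assume x: "x \<in> space M"
      have "\<bar>f n x - p x\<bar> \<le> 2 * C" using bdd[OF x, of n] p_bdd[of x] by linarith
      then show "norm ((f n x - p x) * (f n x - p x)) \<le> (2 * C) * (2 * C)"
        unfolding real_norm_def abs_mult by (intro mult_mono) auto
    qed
  qed (auto)
  then have "(\<lambda>n. nrm (\<lambda>x. f n x - p x)) \<longlonglongrightarrow> sqrt 0"
    unfolding nrm_def ip_def by (intro tendsto_real_sqrt) simp
  then show ?thesis using that[OF p_meas p_bdd] by simp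
qed

text \<open>Two almost invariant lists have nearby averages, since both are close to the double
  average over the two lists, which is symmetric by commutativity. So the limit does not depend on
  the list, and an \<epsilon>-invariant list is already within \<epsilon> of it.\<close>

lemma mean_exists:
  fixes y :: "'h::ab_group_add \<Rightarrow> 'a \<Rightarrow> real"
  assumes meas: "\<And>t. y t \<in> borel_measurable M"
    and bdd: "\<And>t x. x \<in> space M \<Longrightarrow> \<bar>y t x\<bar> \<le> C"
    and inv: "\<And>\<epsilon>. \<epsilon> > 0 \<Longrightarrow> \<exists>\<nu>. \<nu> \<noteq> [] \<and>
      (\<forall>h. nrm (\<lambda>x. avg \<nu> (\<lambda>t. y (h + t) x) - avg \<nu> (\<lambda>t. y t x)) \<le> \<epsilon>)"
  obtains p where "p \<in> borel_measurable M" "\<And>x. x \<in> space M \<Longrightarrow> \<bar>p x\<bar> \<le> C"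
    "\<And>\<nu> \<epsilon>. \<nu> \<noteq> [] \<Longrightarrow> (\<And>h. nrm (\<lambda>x. avg \<nu> (\<lambda>t. y (h + t) x) - avg \<nu> (\<lambda>t. y t x)) \<le> \<epsilon>) \<Longrightarrow>
      nrm (\<lambda>x. avg \<nu> (\<lambda>t. y t x) - p x) \<le> \<epsilon>"
proof -
  define v where "v h \<nu> x = avg \<nu> (\<lambda>t. y (h + t) x)" for h \<nu> x
  define good where "good \<epsilon> \<nu> \<longleftrightarrow> \<nu> \<noteq> [] \<and> (\<forall>h. nrm (\<lambda>x. v h \<nu> x - v 0 \<nu> x) \<le> \<epsilon>)" for \<epsilon> \<nu>
  have ybm: "bm (y t)" for t using meas bdd by (rule bmI)
  have bv: "bm (v h \<nu>)" for h \<nu> unfolding v_def using ybm by (rule bm_avg)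
  have v_bdd: "\<bar>v 0 \<nu> x\<bar> \<le> C" if "\<nu> \<noteq> []" "x \<in> space M" for \<nu> x
    unfolding v_def using that bdd by (intro avg_abs_le) auto
  have close: "nrm (\<lambda>x. v 0 \<nu> x - v 0 \<mu> x) \<le> \<epsilon> + \<delta>" if "good \<epsilon> \<nu>" "good \<delta> \<mu>" for \<epsilon> \<delta> \<mu> \<nu>
  proof -
    let ?w = "\<lambda>x. avg \<mu> (\<lambda>h. v h \<nu> x)"
    have w: "?w x = avg \<nu> (\<lambda>h. v h \<mu> x)" for x
      unfolding v_def by (subst avg_swap) (simp add: add.commute)
    have bw: "bm ?w" by (intro bm_avg bv)
    have "nrm (\<lambda>x. ?w x - v 0 \<nu> x) \<le> \<epsilon>"
      using that by (intro nrm_avg_diff_le bv) (auto simp: good_def)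
    moreover have "nrm (\<lambda>x. ?w x - v 0 \<mu> x) \<le> \<delta>"
      unfolding w using that by (intro nrm_avg_diff_le bv) (auto simp: good_def)
    ultimately show ?thesis
      using nrm_triangle_diff[OF bv[of 0 \<nu>] bw bv[of 0 \<mu>]] nrm_minus_commute[of ?w "v 0 \<nu>"] by simp
  qed
  \<comment> \<open>The errors at \<open>n\<close> and \<open>Suc n\<close> add up to
    \<open>(3/8) * (1/2) ^ n\<close>, within the rate that \<open>bounded_L2_complete\<close> asks
    for.\<close>
  have "\<exists>\<nu>. good ((1/4) * (1/2) ^ n) \<nu>" for n
    using inv[of "(1/4) * (1/2) ^ n"] unfolding good_def v_def by auto
  then obtain N where N: "\<And>n. good ((1/4) * (1/2) ^ n) (N n)" by metis
  have "nrm (\<lambda>x. v 0 (N (Suc n)) x - v 0 (N n) x) \<le> (1/2) ^ n" for n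
  proof -
    have "nrm (\<lambda>x. v 0 (N (Suc n)) x - v 0 (N n) x) \<le> (1/4) * (1/2) ^ Suc n + (1/4) * (1/2) ^ n"
      by (rule close[OF N N])
    also have "\<dots> \<le> (1/2) ^ n" by simp
    finally show ?thesis .
  qed
  moreover have "v 0 (N n) \<in> borel_measurable M" for n using bv by (rule bm_measurable)
  moreover have "\<bar>v 0 (N n) x\<bar> \<le> C" if "x \<in> space M" for n x
    using N[of n] that by (intro v_bdd) (auto simp: good_def)
  ultimately obtain p where p: "p \<in> borel_measurable M" "\<And>x. x \<in> space M \<Longrightarrow> \<bar>p x\<bar> \<le> C"
    "(\<lambda>n. nrm (\<lambda>x. v 0 (N n) x - p x)) \<longlonglongrightarrow> 0"
    using bounded_L2_complete[of "\<lambda>n. v 0 (N n)" C] by blast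
  have bp: "bm p" using p(1,2) by (rule bmI)
  have "nrm (\<lambda>x. v 0 \<nu> x - p x) \<le> \<epsilon>" if "good \<epsilon> \<nu>" for \<epsilon> \<nu>
  proof (rule LIMSEQ_le_const)
    have "(\<lambda>n. \<epsilon> + (1/4) * (1/2) ^ n + nrm (\<lambda>x. v 0 (N n) x - p x)) \<longlonglongrightarrow> \<epsilon> + (1/4) * 0 + 0"
      by (intro tendsto_add tendsto_mult tendsto_const p(3) LIMSEQ_power_zero) simp
    then show "(\<lambda>n. \<epsilon> + (1/4) * (1/2) ^ n + nrm (\<lambda>x. v 0 (N n) x - p x)) \<longlonglongrightarrow> \<epsilon>" by simp
    have "nrm (\<lambda>x. v 0 \<nu> x - p x) \<le> \<epsilon> + (1/4) * (1/2) ^ n + nrm (\<lambda>x. v 0 (N n) x - p x)" for n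
      using nrm_triangle_diff[OF bv[of 0 \<nu>] bv[of 0 "N n"] bp] close[OF that N, of n] by simp
    then show "\<exists>n0. \<forall>n\<ge>n0. nrm (\<lambda>x. v 0 \<nu> x - p x)
        \<le> \<epsilon> + (1/4) * (1/2) ^ n + nrm (\<lambda>x. v 0 (N n) x - p x)" by blast
  qed
  then show ?thesis using that[OF p(1,2)] unfolding good_def v_def by simp
qed

end

section \<open>Almost periodic functions\<close>

lemma finite_range_Pair:
  assumes "finite (range c)" "finite (range d)" shows "finite (range (\<lambda>g. (c g, d g)))"
  by (rule finite_subset[of _ "range c \<times> range d"]) (use assms in auto)

text \<open>Colourings arise with values in pairs and lists, whereas the definition of
  \<open>ap\<close> must fix one colour type; only the partition into colour classes
  matters.\<close>

lemma nat_colouring: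
  assumes "finite (range (c :: 'b \<Rightarrow> 'c))"
  obtains c' :: "'b \<Rightarrow> nat" where "finite (range c')" "\<And>g h. c' g = c' h \<longleftrightarrow> c g = c h"
proof -
  obtain i :: "'c \<Rightarrow> nat" where i: "inj_on i (range c)"
    using finite_imp_inj_to_nat_seg[OF assms] by blast
  have "finite (range (i \<circ> c))" using assms by (metis finite_imageI image_comp)
  moreover have "(i \<circ> c) g = (i \<circ> c) h \<longleftrightarrow> c g = c h" for g h using i by (auto dest: inj_onD)
  ultimately show ?thesis using that by blast
qed

locale mps = prob_space M for M :: "'x measure" +
  fixes T :: "'g::{ab_group_add, countable} \<Rightarrow> 'x \<Rightarrow> 'x"
  assumes T_measurable [measurable]: "T g \<in> M \<rightarrow>\<^sub>M M"
    and T_distr: "distr M M (T g) = M"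
    and T_zero: "x \<in> space M \<Longrightarrow> T 0 x = x"
    and T_add: "x \<in> space M \<Longrightarrow> T (g + h) x = T g (T h x)"
begin

lemma T_space: "x \<in> space M \<Longrightarrow> T g x \<in> space M"
  using measurable_space[OF T_measurable] .

lemma bm_T: assumes "bm f" shows "bm (\<lambda>x. f (T g x))"
proof -
  obtain C where "\<forall>x\<in>space M. \<bar>f x\<bar> \<le> C" using bm_bound[OF assms] by blast
  then show ?thesis using bm_measurable[OF assms] T_space by (intro bmI[of _ C]) auto
qed

lemma integral_T: "f \<in> borel_measurable M \<Longrightarrow> (\<integral>x. f (T g x) \<partial>M) = (\<integral>x. f x \<partial>M)" for f :: "'x \<Rightarrow> real"
  using integral_distr[of "T g" M M f] by (simp add: T_distr)

lemma AE_T: "AE x in M. P x \<Longrightarrow> AE x in M. P (T g x)"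
  using AE_distrD[OF T_measurable, of P g] unfolding T_distr .

lemma ip_T: "bm f \<Longrightarrow> bm h \<Longrightarrow> ip (\<lambda>x. f (T a x)) (\<lambda>x. h (T a x)) = ip f h"
  unfolding ip_def using integral_T[of "\<lambda>x. f x * h x" a] bm_measurable[OF bm_mult] by blast

lemma nrm_T: "bm f \<Longrightarrow> nrm (\<lambda>x. f (T a x)) = nrm f"
  by (simp add: nrm_def ip_T)

lemma ip_T_add:
  assumes "bm f" "bm h"
  shows "ip (\<lambda>x. f (T (a + b) x)) (\<lambda>x. h (T (a + c) x)) = ip (\<lambda>x. f (T b x)) (\<lambda>x. h (T c x))"
proof -
  have "ip (\<lambda>x. f (T (a + b) x)) (\<lambda>x. h (T (a + c) x))
      = ip (\<lambda>x. f (T b (T a x))) (\<lambda>x. h (T c (T a x)))"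
    by (intro ip_cong) (simp_all add: T_add[symmetric] add.commute)
  also have "\<dots> = ip (\<lambda>x. f (T b x)) (\<lambda>x. h (T c x))"
    using ip_T[OF bm_T[OF assms(1), of b] bm_T[OF assms(2), of c], of a] .
  finally show ?thesis .
qed

lemma nrm_T_add:
  assumes "bm f"
  shows "nrm (\<lambda>x. f (T (a + b) x) - f (T (a + c) x)) = nrm (\<lambda>x. f (T b x) - f (T c x))"
proof -
  have "nrm (\<lambda>x. f (T (a + b) x) - f (T (a + c) x)) = nrm (\<lambda>x. f (T b (T a x)) - f (T c (T a x)))"
    by (intro nrm_cong) (simp add: T_add[symmetric] add.commute)
  also have "\<dots> = nrm (\<lambda>x. f (T b x) - f (T c x))"
    using nrm_T[OF bm_diff[OF bm_T[OF assms, of b] bm_T[OF assms, of c]], of a] .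
  finally show ?thesis .
qed

text \<open>Functions with totally bounded orbit in \<open>L\<^sup>2\<close>; total boundedness is expressed by finite
  colourings of the group, which makes joint refinements trivial.\<close>
definition ap :: "('x \<Rightarrow> real) \<Rightarrow> bool" where
  "ap f \<longleftrightarrow> bm f \<and> (\<forall>\<epsilon>>0. \<exists>c :: 'g \<Rightarrow> nat. finite (range c) \<and>
     (\<forall>g h. c g = c h \<longrightarrow> nrm (\<lambda>x. f (T g x) - f (T h x)) \<le> \<epsilon>))"

lemma ap_bm: "ap f \<Longrightarrow> bm f"
  unfolding ap_def by blast

lemma apI:
  assumes "bm f" "\<And>\<epsilon>. \<epsilon> > 0 \<Longrightarrow> \<exists>c :: 'g \<Rightarrow> 'c. finite (range c) \<and>
     (\<forall>g h. c g = c h \<longrightarrow> nrm (\<lambda>x. f (T g x) - f (T h x)) \<le> \<epsilon>)"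
  shows "ap f"
  unfolding ap_def
proof (intro conjI allI impI)
  fix \<epsilon> :: real assume "\<epsilon> > 0"
  then obtain c :: "'g \<Rightarrow> 'c" where c: "finite (range c)"
    "\<And>g h. c g = c h \<Longrightarrow> nrm (\<lambda>x. f (T g x) - f (T h x)) \<le> \<epsilon>" using assms(2) by blast
  then show "\<exists>c :: 'g \<Rightarrow> nat. finite (range c) \<and>
      (\<forall>g h. c g = c h \<longrightarrow> nrm (\<lambda>x. f (T g x) - f (T h x)) \<le> \<epsilon>)"
    using nat_colouring[OF c(1)] by metis
qed (rule assms)

lemma apD:
  assumes "ap f" "\<epsilon> > 0"
  obtains c :: "'g \<Rightarrow> nat" where "finite (range c)"
    "\<And>g h. c g = c h \<Longrightarrow> nrm (\<lambda>x. f (T g x) - f (T h x)) \<le> \<epsilon>"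
  using assms unfolding ap_def by blast

lemma ap_const: "ap (\<lambda>x. a)"
proof (rule apI[OF bm_const])
  fix \<epsilon> :: real assume "\<epsilon> > 0"
  then show "\<exists>c :: 'g \<Rightarrow> nat. finite (range c) \<and> (\<forall>g h. c g = c h \<longrightarrow> nrm (\<lambda>x. a - a) \<le> \<epsilon>)"
    by (intro exI[of _ "\<lambda>_. 0"]) (simp add: nrm_def ip_def)
qed

lemma ap_add: assumes "ap f" "ap k" shows "ap (\<lambda>x. f x + k x)"
proof (rule apI)
  show "bm (\<lambda>x. f x + k x)" using assms by (intro bm_add ap_bm)
  fix \<epsilon> :: real assume "\<epsilon> > 0"
  then have e: "\<epsilon> / 2 > 0" by simp
  obtain c :: "'g \<Rightarrow> nat" where c: "finite (range c)"
    "\<And>g h. c g = c h \<Longrightarrow> nrm (\<lambda>x. f (T g x) - f (T h x)) \<le> \<epsilon> / 2" using apD[OF assms(1) e] by blast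
  obtain d :: "'g \<Rightarrow> nat" where d: "finite (range d)"
    "\<And>g h. d g = d h \<Longrightarrow> nrm (\<lambda>x. k (T g x) - k (T h x)) \<le> \<epsilon> / 2" using apD[OF assms(2) e] by blast
  have "nrm (\<lambda>x. (f (T g x) + k (T g x)) - (f (T h x) + k (T h x))) \<le> \<epsilon>"
    if "c g = c h" "d g = d h" for g h
  proof -
    have "nrm (\<lambda>x. (f (T g x) + k (T g x)) - (f (T h x) + k (T h x)))
        = nrm (\<lambda>x. (f (T g x) - f (T h x)) + (k (T g x) - k (T h x)))"
      by (simp add: algebra_simps)
    also have "\<dots> \<le> nrm (\<lambda>x. f (T g x) - f (T h x)) + nrm (\<lambda>x. k (T g x) - k (T h x))"
      using assms by (intro nrm_triangle bm_diff bm_T ap_bm)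
    finally show ?thesis using c(2)[OF that(1)] d(2)[OF that(2)] by simp
  qed
  then show "\<exists>c :: 'g \<Rightarrow> nat \<times> nat. finite (range c) \<and> (\<forall>g h. c g = c h \<longrightarrow>
      nrm (\<lambda>x. (f (T g x) + k (T g x)) - (f (T h x) + k (T h x))) \<le> \<epsilon>)"
    using finite_range_Pair[OF c(1) d(1)] by (intro exI[of _ "\<lambda>g. (c g, d g)"]) auto
qed

text \<open>A Lipschitz map stretches distances within the orbit by at most \<open>L\<close>. It is
  applied to scalar multiples, to clipping at 0 and 1, and to squaring.\<close>

lemma ap_compose:
  assumes "ap f" "bm (\<lambda>x. \<Phi> (f x))" "L \<ge> 0"
    and lip: "\<And>x y. x \<in> space M \<Longrightarrow> y \<in> space M \<Longrightarrow> \<bar>\<Phi> (f x) - \<Phi> (f y)\<bar> \<le> L * \<bar>f x - f y\<bar>"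
  shows "ap (\<lambda>x. \<Phi> (f x))"
proof (rule apI[OF assms(2)])
  fix \<epsilon> :: real assume "\<epsilon> > 0"
  then have "\<epsilon> / (L + 1) > 0" using \<open>L \<ge> 0\<close> by simp
  then obtain c :: "'g \<Rightarrow> nat" where c: "finite (range c)"
    "\<And>g h. c g = c h \<Longrightarrow> nrm (\<lambda>x. f (T g x) - f (T h x)) \<le> \<epsilon> / (L + 1)" using apD[OF assms(1)] by blast
  have "nrm (\<lambda>x. \<Phi> (f (T g x)) - \<Phi> (f (T h x))) \<le> \<epsilon>" if "c g = c h" for g h
  proof -
    have "nrm (\<lambda>x. \<Phi> (f (T g x)) - \<Phi> (f (T h x))) \<le> nrm (\<lambda>x. L * (f (T g x) - f (T h x)))"
    proof (rule nrm_mono)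
      show "bm (\<lambda>x. \<Phi> (f (T g x)) - \<Phi> (f (T h x)))"
        using bm_T[OF assms(2)] by (intro bm_diff)
      show "bm (\<lambda>x. L * (f (T g x) - f (T h x)))"
        using assms(1) by (intro bm_cmult bm_diff bm_T ap_bm)
    qed (use lip T_space \<open>L \<ge> 0\<close> in \<open>auto simp: abs_mult\<close>)
    also have "\<dots> \<le> L * (\<epsilon> / (L + 1))"
      unfolding nrm_cmult using mult_left_mono[OF c(2)[OF that] \<open>L \<ge> 0\<close>] \<open>L \<ge> 0\<close> by simp
    also have "\<dots> \<le> \<epsilon>" using \<open>L \<ge> 0\<close> \<open>\<epsilon> > 0\<close> by (simp add: field_simps)
    finally show ?thesis .
  qed
  then show "\<exists>c :: 'g \<Rightarrow> nat. finite (range c) \<and> (\<forall>g h. c g = c h \<longrightarrow>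
      nrm (\<lambda>x. \<Phi> (f (T g x)) - \<Phi> (f (T h x))) \<le> \<epsilon>)" using c(1) by blast
qed

lemma ap_cmult: "ap f \<Longrightarrow> ap (\<lambda>x. a * f x)"
  by (rule ap_compose[where L = "\<bar>a\<bar>"])
    (auto simp: ap_bm bm_cmult abs_mult right_diff_distrib[symmetric])

lemma ap_T: assumes "ap f" shows "ap (\<lambda>x. f (T a x))"
proof (rule apI)
  show "bm (\<lambda>x. f (T a x))" using assms by (intro bm_T ap_bm)
  fix \<epsilon> :: real assume "\<epsilon> > 0"
  then obtain c :: "'g \<Rightarrow> nat" where c: "finite (range c)"
    "\<And>g h. c g = c h \<Longrightarrow> nrm (\<lambda>x. f (T g x) - f (T h x)) \<le> \<epsilon>" using apD[OF assms] by blast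
  have "nrm (\<lambda>x. f (T a (T g x)) - f (T a (T h x))) = nrm (\<lambda>x. f (T (a + g) x) - f (T (a + h) x))"
    for g h by (intro nrm_cong) (simp add: T_add)
  then show "\<exists>c :: 'g \<Rightarrow> nat. finite (range c) \<and> (\<forall>g h. c g = c h \<longrightarrow>
      nrm (\<lambda>x. f (T a (T g x)) - f (T a (T h x))) \<le> \<epsilon>)"
    using c(2) nrm_T_add[OF ap_bm[OF assms]] by (intro exI[of _ c]) (simp add: c(1))
qed

lemma nrm_T_diff_le:
  assumes "bm f" "bm k" "nrm (\<lambda>x. k x - f x) \<le> \<delta>"
  shows "nrm (\<lambda>x. f (T g x) - f (T h x)) \<le> 2 * \<delta> + nrm (\<lambda>x. k (T g x) - k (T h x))"
proof -
  have "nrm (\<lambda>x. f (T g x) - f (T h x))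
      \<le> nrm (\<lambda>x. f (T g x) - k (T g x)) + nrm (\<lambda>x. k (T g x) - f (T h x))"
    using assms by (intro nrm_triangle_diff bm_T)
  also have "nrm (\<lambda>x. k (T g x) - f (T h x))
      \<le> nrm (\<lambda>x. k (T g x) - k (T h x)) + nrm (\<lambda>x. k (T h x) - f (T h x))"
    using assms by (intro nrm_triangle_diff bm_T)
  finally show ?thesis
    using assms(3) nrm_T[OF bm_diff[OF assms(2,1)]] nrm_T[OF bm_diff[OF assms(1,2)]]
      nrm_minus_commute[of f k] by simp
qed

lemma ap_limit:
  assumes "bm f" "\<And>\<epsilon>. \<epsilon> > 0 \<Longrightarrow> \<exists>k. ap k \<and> nrm (\<lambda>x. k x - f x) \<le> \<epsilon>"
  shows "ap f"
proof (rule apI[OF assms(1)])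
  fix \<epsilon> :: real assume "\<epsilon> > 0"
  then have e: "\<epsilon> / 3 > 0" by simp
  then obtain k where k: "ap k" "nrm (\<lambda>x. k x - f x) \<le> \<epsilon> / 3" using assms(2) by blast
  obtain c :: "'g \<Rightarrow> nat" where c: "finite (range c)"
    "\<And>g h. c g = c h \<Longrightarrow> nrm (\<lambda>x. k (T g x) - k (T h x)) \<le> \<epsilon> / 3" using apD[OF k(1) e] by blast
  have "nrm (\<lambda>x. f (T g x) - f (T h x)) \<le> \<epsilon>" if "c g = c h" for g h
    using nrm_T_diff_le[OF assms(1) ap_bm[OF k(1)] k(2), of g h] c(2)[OF that] by simp
  then show "\<exists>c :: 'g \<Rightarrow> nat. finite (range c) \<and> (\<forall>g h. c g = c h \<longrightarrow>
      nrm (\<lambda>x. f (T g x) - f (T h x)) \<le> \<epsilon>)" using c(1) by blast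
qed

text \<open>Nearest point argument. Clipping keeps a function almost periodic and does not move it
  away from \<open>f\<close>, so a minimising sequence may be taken with values in [0, 1]; first
  variation at the minimum yields orthogonality.\<close>

lemma ap_projection:
  assumes meas: "f \<in> borel_measurable M" and f01: "\<And>x. x \<in> space M \<Longrightarrow> 0 \<le> f x \<and> f x \<le> 1"
  obtains k where "ap k" "\<And>x. x \<in> space M \<Longrightarrow> 0 \<le> k x \<and> k x \<le> 1"
    "\<And>l. ap l \<Longrightarrow> ip (\<lambda>x. f x - k x) l = 0"
proof -
  define D where "D k = ip (\<lambda>x. f x - k x) (\<lambda>x. f x - k x)" for k
  define d where "d = Inf (D ` {k. ap k})"
  have bf: "bm f" by (rule bmI[OF meas, of 1]) (use f01 in auto)
  have bb: "bdd_below (D ` {k. ap k})" by (auto simp: D_def ip_nonneg intro!: bdd_belowI[of _ 0])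
  have d_le: "d \<le> D k" if "ap k" for k unfolding d_def using bb that by (intro cInf_lower) auto
  \<comment> \<open>These errors bound the squared increments by \<open>(5/8) * (1/4) ^ n\<close>,
    hence the increments by \<open>(1/2) ^ n\<close>.\<close>
  have trunc: "\<exists>k. ap k \<and> (\<forall>x. 0 \<le> k x \<and> k x \<le> 1) \<and> D k < d + (1/4) * (1/4) ^ n" for n
  proof -
    have "\<exists>y\<in>D ` {k. ap k}. y < d + (1/4) * (1/4) ^ n"
      unfolding d_def using bb ap_const by (subst cInf_less_iff[symmetric]) auto
    then obtain k where k: "ap k" "D k < d + (1/4) * (1/4) ^ n" by auto
    let ?k = "\<lambda>x. max 0 (min 1 (k x))"
    have bk: "bm ?k"
      using bm_measurable[OF ap_bm[OF k(1)]] by (intro bmI[of _ 1]) auto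
    have "ap ?k" using k(1) bk by (rule ap_compose[where L = 1]) auto
    moreover have "D ?k \<le> D k" unfolding D_def
    proof (rule ip_mono)
      show "\<bar>f x - ?k x\<bar> \<le> \<bar>f x - k x\<bar>" if "x \<in> space M" for x using f01[OF that] by auto
    qed (intro bm_diff bf bk ap_bm k)+
    ultimately show ?thesis using k(2) by (intro exI[of _ ?k]) auto
  qed
  then obtain K where K: "\<And>n. ap (K n)" "\<And>n x. 0 \<le> K n x \<and> K n x \<le> 1"
    "\<And>n. D (K n) < d + (1/4) * (1/4) ^ n" by metis
  have bK: "bm (K n)" for n using K(1) by (rule ap_bm)
  have "nrm (\<lambda>x. K (Suc n) x - K n x) \<le> (1/2) ^ n" for n
  proof (rule power2_le_imp_le)
    let ?a = "\<lambda>x. f x - K n x" and ?b = "\<lambda>x. f x - K (Suc n) x"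
    have b: "bm ?a" "bm ?b" using bf bK by (auto intro: bm_diff)
    \<comment> \<open>Parallelogram identity: the midpoint is admissible, so its squared distance is
      at least \<open>d\<close>, which leaves little room for the difference.\<close>
    have "ap (\<lambda>x. (1/2) * (K n x + K (Suc n) x))" by (intro ap_cmult ap_add K)
    from d_le[OF this] have "d \<le> ip (\<lambda>x. (1/2) * (?a x + ?b x)) (\<lambda>x. (1/2) * (?a x + ?b x))"
      unfolding D_def by (simp add: field_simps)
    also have "\<dots> = (1/4) * (ip ?a ?a + 2 * ip ?a ?b + ip ?b ?b)"
      using b by (simp only: ip_cmult_left ip_cmult_right ip_add_left ip_add_right bm_add
          ip_commute[of ?b ?a]) simp
    finally have 1: "4 * d \<le> D (K n) + 2 * ip ?a ?b + D (K (Suc n))" by (simp add: D_def)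
    have "(nrm (\<lambda>x. K (Suc n) x - K n x))\<^sup>2 = ip (\<lambda>x. ?a x - ?b x) (\<lambda>x. ?a x - ?b x)"
      unfolding nrm_square by simp
    also have "\<dots> = D (K n) - 2 * ip ?a ?b + D (K (Suc n))"
      using b by (simp only: ip_diff_left ip_diff_right bm_diff ip_commute[of ?b ?a] D_def)
    also have "\<dots> \<le> (1/4) ^ n"
    proof -
      have "0 \<le> (1/4::real) ^ n" by simp
      then show ?thesis using 1 K(3)[of n] K(3)[of "Suc n", unfolded power_Suc] by linarith
    qed
    also have "(1/4::real) ^ n = ((1/2) ^ n)\<^sup>2"
      by (simp add: power_divide power_mult[symmetric] mult.commute[of n] power_mult)
    finally show "(nrm (\<lambda>x. K (Suc n) x - K n x))\<^sup>2 \<le> ((1/2) ^ n)\<^sup>2" .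
  qed simp
  moreover have "K n \<in> borel_measurable M" for n using bK by (rule bm_measurable)
  moreover have "\<bar>K n x\<bar> \<le> 1" for n x using K(2)[of n x] by auto
  ultimately obtain p where p: "p \<in> borel_measurable M" "\<And>x. x \<in> space M \<Longrightarrow> \<bar>p x\<bar> \<le> 1"
    "(\<lambda>n. nrm (\<lambda>x. K n x - p x)) \<longlonglongrightarrow> 0"
    using bounded_L2_complete[of K 1] by blast
  \<comment> \<open>Completeness only gives \<open>\<bar>p x\<bar> \<le> 1\<close>; the positive
    part restores the lower bound and is no farther from the nonnegative \<open>K n\<close>.\<close>
  define k where "k x = max 0 (p x)" for x
  have k01: "0 \<le> k x \<and> k x \<le> 1" if "x \<in> space M" for x
    using p(2)[OF that] by (auto simp: k_def)
  have bk: "bm k" unfolding k_def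
    using p by (intro bmI[of _ 1]) (auto simp: max_def abs_le_iff)
  have bp: "bm p" using p(1,2) by (rule bmI)
  have le: "nrm (\<lambda>x. K n x - k x) \<le> nrm (\<lambda>x. K n x - p x)" for n
  proof (rule nrm_mono)
    show "\<bar>K n x - k x\<bar> \<le> \<bar>K n x - p x\<bar>" for x
      using K(2)[of n x] by (auto simp: k_def)
  qed (intro bm_diff bK bk bp)+
  have lim: "(\<lambda>n. nrm (\<lambda>x. K n x - k x)) \<longlonglongrightarrow> 0"
    by (rule tendsto_sandwich[OF _ _ tendsto_const p(3)]) (auto simp: le nrm_nonneg)
  have apk: "ap k"
  proof (rule ap_limit[OF bk])
    fix \<epsilon> :: real assume "\<epsilon> > 0"
    from order_tendstoD(2)[OF lim this] obtain n where "nrm (\<lambda>x. K n x - k x) < \<epsilon>"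
      by (auto simp: eventually_sequentially)
    then show "\<exists>l. ap l \<and> nrm (\<lambda>x. l x - k x) \<le> \<epsilon>" using K(1) by (auto intro: less_imp_le)
  qed
  have "nrm (\<lambda>x. f x - k x) \<le> sqrt d"
  proof (rule LIMSEQ_le_const)
    have "(\<lambda>n. sqrt (d + (1/4) * (1/4) ^ n) + nrm (\<lambda>x. K n x - k x)) \<longlonglongrightarrow> sqrt (d + (1/4) * 0) + 0"
      by (intro tendsto_add tendsto_real_sqrt tendsto_mult tendsto_const lim LIMSEQ_power_zero) simp
    then show "(\<lambda>n. sqrt (d + (1/4) * (1/4) ^ n) + nrm (\<lambda>x. K n x - k x)) \<longlonglongrightarrow> sqrt d" by simp
    have "nrm (\<lambda>x. f x - k x) \<le> sqrt (d + (1/4) * (1/4) ^ n) + nrm (\<lambda>x. K n x - k x)" for n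
    proof -
      have "nrm (\<lambda>x. f x - K n x) \<le> sqrt (d + (1/4) * (1/4) ^ n)"
        unfolding nrm_def using K(3)[of n] unfolding D_def by simp
      then show ?thesis using nrm_triangle_diff[OF bf bK[of n] bk] by simp
    qed
    then show "\<exists>n0. \<forall>n\<ge>n0. nrm (\<lambda>x. f x - k x) \<le> sqrt (d + (1/4) * (1/4) ^ n) + nrm (\<lambda>x. K n x - k x)"
      by blast
  qed
  then have Dk: "D k \<le> d" unfolding nrm_def D_def by simp
  have "ip (\<lambda>x. f x - k x) l = 0" if l: "ap l" for l
  proof -
    have bl: "bm l" using l by (rule ap_bm)
    \<comment> \<open>Minimality of \<open>D k\<close> removes the constant term of the quadratic in
      \<open>r\<close>, so the linear coefficient must vanish.\<close>
    have "(- ip (\<lambda>x. f x - k x) l)\<^sup>2 \<le> 0 * ip l l"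
    proof (rule quadratic_nonneg_imp)
      fix r
      have "d \<le> D (\<lambda>x. k x + r * l x)" by (intro d_le ap_add ap_cmult apk l)
      also have "\<dots> = ip (\<lambda>x. (f x - k x) - r * l x) (\<lambda>x. (f x - k x) - r * l x)"
        unfolding D_def by (simp add: algebra_simps)
      also have "\<dots> = D k - 2 * r * ip (\<lambda>x. f x - k x) l + r\<^sup>2 * ip l l"
      proof -
        define u where "u = (\<lambda>x. f x - k x)"
        have bu: "bm u" unfolding u_def using bf bk by (rule bm_diff)
        have "ip (\<lambda>x. u x - r * l x) (\<lambda>x. u x - r * l x)
            = ip u u - r * ip u l - (r * ip u l - r * (r * ip l l))"
          using bu bl by (simp only: ip_diff_left ip_diff_right bm_diff bm_cmult ip_cmult_left
              ip_cmult_right ip_commute[of l u] right_diff_distrib)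
        then show ?thesis unfolding D_def u_def by (simp add: power2_eq_square)
      qed
      finally show "0 \<le> 0 + 2 * r * - ip (\<lambda>x. f x - k x) l + r\<^sup>2 * ip l l" using Dk by simp
    qed
    then show ?thesis by simp
  qed
  then show ?thesis using that[OF apk k01] by blast
qed

end

section \<open>Mixing functions\<close>

context prob_space
begin

text \<open>The Hilbert--Schmidt bound: \<open>\<Sum> \<alpha>\<^sub>i \<langle>Y\<^sub>i, b\<rangle> \<langle>Y\<^sub>i, c\<rangle>\<close> is the pairing of
  \<open>\<Sum> \<alpha>\<^sub>i Y\<^sub>i \<otimes> Y\<^sub>i\<close> with \<open>b \<otimes> c\<close>.\<close>
lemma tensor_Cauchy_Schwarz:
  assumes "\<And>i. bm (Y i)" "bm b" "bm c"
  shows "(\<Sum>(\<alpha>, i)\<leftarrow>xs. \<alpha> * (ip (Y i) b * ip (Y i) c))\<^sup>2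
    \<le> (\<Sum>(\<alpha>, i)\<leftarrow>xs. \<Sum>(\<beta>, j)\<leftarrow>xs. \<alpha> * \<beta> * (ip (Y i) (Y j))\<^sup>2) * (ip b b * ip c c)"
proof -
  \<comment> \<open>\<open>None\<close> indexes \<open>b \<otimes> c\<close> and
    \<open>Some i\<close> indexes \<open>Y i \<otimes> Y i\<close>; the product of the two Gram
    kernels is the Gram kernel of these tensors.\<close>
  define B where "B i = (case i of None \<Rightarrow> b | Some i \<Rightarrow> Y i)" for i
  define C where "C i = (case i of None \<Rightarrow> c | Some i \<Rightarrow> Y i)" for i
  have "psd (\<lambda>i j. ip (B i) (B j) * ip (C i) (C j))"
    using assms by (intro psd_times_ip psd_ip) (auto simp: B_def C_def split: option.split)
  from psd_Cauchy_Schwarz[OF this, where xs = "map (\<lambda>(\<alpha>, i). (\<alpha>, Some i)) xs" and j = None]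
  show ?thesis
    by (simp add: ip_commute B_def C_def comp_def case_prod_unfold power2_eq_square)
qed

end

text \<open>Presents the change of an average under translation as a single sum with signed
  coefficients, the input format of \<open>tensor_Cauchy_Schwarz\<close>.\<close>

lemma sum_list_shift_diff:
  "(\<Sum>(\<alpha>, i)\<leftarrow>map (\<lambda>t. (1 / real (length \<nu>), h + t)) \<nu> @ map (\<lambda>t. (- 1 / real (length \<nu>), t)) \<nu>.
      \<alpha> * F i) = avg \<nu> (\<lambda>t. F (h + t)) - avg \<nu> F"
  using sum_list_const_mult[of "- 1 / real (length \<nu>)" F \<nu>]
    sum_list_const_mult[of "1 / real (length \<nu>)" "\<lambda>t. F (h + t)" \<nu>]
  by (simp add: comp_def avg_def)

context mps
begin

text \<open>The averages of \<open>Y t \<otimes> Y t\<close> behave like a Hilbert-Schmidt operator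
  commuting with the action of \<phi>(G). It sends \<open>b\<close> to some \<open>p\<close> that is
  nearly a value of a finite-rank operator, so the \<phi>(G)-orbit of \<open>p\<close> is totally
  bounded, and by finite index \<open>p\<close> is almost periodic. Hence \<open>p\<close> is
  orthogonal to the functions \<open>Y t\<close> from which it is built, so it is null.\<close>

lemma mixing_of_orthogonal_ap:
  assumes f: "bm f" and orth: "\<And>k. ap k \<Longrightarrow> ip f k = 0"
    and hom: "additive_hom \<phi>" and R: "finite R" "\<And>g. \<exists>r\<in>R. \<exists>h. g = r + \<phi> h"
    and \<epsilon>: "\<epsilon> > 0"
  shows "\<exists>\<nu>. \<nu> \<noteq> [] \<and> (\<forall>b. bm b \<longrightarrow> avg \<nu> (\<lambda>t. (ip (\<lambda>x. f (T (\<phi> t) x)) b)\<^sup>2) \<le> \<epsilon> * ip b b)"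
proof -
  have \<phi>_add: "\<phi> (s + t) = \<phi> s + \<phi> t" for s t using hom by (simp add: additive_hom_def)
  define Y where "Y t = (\<lambda>x. f (T (\<phi> t) x))" for t
  have bY: "bm (Y t)" for t unfolding Y_def using f by (rule bm_T)
  have nY: "nrm (Y t) = nrm f" for t unfolding Y_def using f by (rule nrm_T)
  obtain C where C: "C \<ge> 0" "\<forall>x\<in>space M. \<bar>f x\<bar> \<le> C" using bm_bound[OF f] by blast
  have YC: "\<bar>Y t x\<bar> \<le> C" if "x \<in> space M" for t x using C(2) T_space[OF that] by (simp add: Y_def)
  \<comment> \<open>Up to the difference of indices this is the Gram kernel of the tensors
    \<open>Y t \<otimes> Y t\<close>; squaring makes the almost invariant list control operators
    instead of vectors.\<close>
  define \<kappa> where "\<kappa> g = (ip (Y g) (Y 0))\<^sup>2" for g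
  have \<kappa>: "(ip (Y t) (Y s))\<^sup>2 = \<kappa> (t - s)" for t s
    using ip_T_add[OF f f, of "\<phi> s" "\<phi> (t - s)" "\<phi> 0"]
    by (simp add: \<kappa>_def Y_def \<phi>_add[symmetric])
  have \<kappa>_even: "\<kappa> (- g) = \<kappa> g" for g
    using \<kappa>[of 0 g] \<kappa>[of g 0] by (simp add: ip_commute)
  have \<kappa>_bdd: "\<bar>\<kappa> g\<bar> \<le> (nrm f * nrm f)\<^sup>2" for g
  proof -
    have "\<bar>ip (Y g) (Y 0)\<bar> \<le> \<bar>nrm f * nrm f\<bar>"
      using ip_le_nrm[OF bY bY, of g 0] by (simp add: nY)
    then show ?thesis unfolding \<kappa>_def by (simp only: abs_le_square_iff abs_power2)
  qed
  define V where "V h b \<nu> x = avg \<nu> (\<lambda>t. ip (Y (h + t)) b * Y (h + t) x)" for h b \<nu> x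
  have bV: "bm (V h b \<nu>)" for h b \<nu> unfolding V_def by (intro bm_avg bm_cmult bY)
  have ip_V: "ip (V h b \<nu>) c = avg \<nu> (\<lambda>t. ip (Y (h + t)) b * ip (Y (h + t)) c)"
    if "bm c" for h b c \<nu>
    unfolding V_def using that by (subst ip_avg_left) (auto intro!: bm_cmult bY simp: ip_cmult_left)
  have almost_inv: "\<exists>\<nu>. \<nu> \<noteq> [] \<and> (\<forall>b. bm b \<longrightarrow> (\<forall>h. nrm (\<lambda>x. V h b \<nu> x - V 0 b \<nu> x) \<le> \<delta> * nrm b))"
    if "\<delta> > 0" for \<delta>
  proof -
    have "\<delta>\<^sup>2 / 2 > 0" using that by simp
    then obtain \<nu> where \<nu>: "\<nu> \<noteq> []" "\<And>h. avg \<nu> (\<lambda>t. avg \<nu> (\<lambda>s. \<kappa> (t - s)))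
        - avg \<nu> (\<lambda>t. avg \<nu> (\<lambda>s. \<kappa> (h + t - s))) \<le> \<delta>\<^sup>2 / 2"
      using almost_invariant_list[of \<kappa>, OF \<kappa>_bdd \<kappa>_even] by meson
    have "nrm (\<lambda>x. V h b \<nu> x - V 0 b \<nu> x) \<le> \<delta> * nrm b" if b: "bm b" for h b
    proof -
      define D where "D = (\<lambda>x. V h b \<nu> x - V 0 b \<nu> x)"
      have bD: "bm D" unfolding D_def by (intro bm_diff bV)
      let ?xs = "map (\<lambda>t. (1 / real (length \<nu>), h + t)) \<nu> @ map (\<lambda>t. (- 1 / real (length \<nu>), t)) \<nu>"
      \<comment> \<open>Testing the difference against itself, \<open>c = D\<close>, leads to
        \<open>(ip D D)\<^sup>2 \<le> \<delta>\<^sup>2 * (ip b b * ip D D)\<close>, from which one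
        factor cancels.\<close>
      have 1: "ip D D = (\<Sum>(\<alpha>, i)\<leftarrow>?xs. \<alpha> * (ip (Y i) b * ip (Y i) D))"
        unfolding sum_list_shift_diff
        by (subst (1) D_def) (simp add: ip_diff_left bV bD ip_V)
      have e: "\<kappa> (t - (h + s)) = \<kappa> (h + s - t)" for t s
        using \<kappa>_even[of "h + s - t"] by (simp add: algebra_simps)
      have "(\<Sum>(\<alpha>, i)\<leftarrow>?xs. \<Sum>(\<beta>, j)\<leftarrow>?xs. \<alpha> * \<beta> * (ip (Y i) (Y j))\<^sup>2)
          = (\<Sum>(\<alpha>, i)\<leftarrow>?xs. \<alpha> * (\<Sum>(\<beta>, j)\<leftarrow>?xs. \<beta> * \<kappa> (i - j)))"
        unfolding \<kappa> case_prod_unfold sum_list_const_mult[symmetric] by (simp only: mult.assoc)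
      also have "\<dots> = avg \<nu> (\<lambda>t. avg \<nu> (\<lambda>s. \<kappa> (t - s)) - avg \<nu> (\<lambda>s. \<kappa> (h + t - s)))
          - avg \<nu> (\<lambda>t. avg \<nu> (\<lambda>s. \<kappa> (t - (h + s))) - avg \<nu> (\<lambda>s. \<kappa> (t - s)))"
        unfolding sum_list_shift_diff by simp
      also have "\<dots> = 2 * (avg \<nu> (\<lambda>t. avg \<nu> (\<lambda>s. \<kappa> (t - s))) - avg \<nu> (\<lambda>t. avg \<nu> (\<lambda>s. \<kappa> (h + t - s))))"
        unfolding avg_diff e avg_swap[of \<nu> \<nu> "\<lambda>t s. \<kappa> (h + s - t)"] by simp
      also have "\<dots> \<le> \<delta>\<^sup>2" using \<nu>(2)[of h] by simp
      finally have 2: "(\<Sum>(\<alpha>, i)\<leftarrow>?xs. \<Sum>(\<beta>, j)\<leftarrow>?xs. \<alpha> * \<beta> * (ip (Y i) (Y j))\<^sup>2) \<le> \<delta>\<^sup>2" .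
      have "(ip D D)\<^sup>2 \<le> \<delta>\<^sup>2 * (ip b b * ip D D)"
        using order_trans[OF tensor_Cauchy_Schwarz[where Y = Y and xs = ?xs, OF bY b bD]
            mult_right_mono[OF 2]] ip_nonneg unfolding 1[symmetric] by simp
      then have "ip D D * ip D D \<le> (\<delta>\<^sup>2 * ip b b) * ip D D"
        by (simp add: power2_eq_square mult.assoc)
      then have "ip D D \<le> \<delta>\<^sup>2 * ip b b"
        using ip_nonneg[of D] ip_nonneg[of b] by (cases "ip D D = 0") (auto simp: mult_le_cancel_right)
      then have "(nrm D)\<^sup>2 \<le> (\<delta> * nrm b)\<^sup>2" by (simp add: nrm_square power_mult_distrib)
      then show ?thesis unfolding D_def
        by (rule power2_le_imp_le) (use \<open>\<delta> > 0\<close> in \<open>simp add: nrm_nonneg\<close>)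
    qed
    then show ?thesis using \<nu>(1) by blast
  qed
  \<comment> \<open>Fixed before \<open>b\<close>: the limit \<open>p\<close> below depends on
    \<open>b\<close>, but this list works for all of them.\<close>
  obtain \<nu> where \<nu>: "\<nu> \<noteq> []" "\<And>b h. bm b \<Longrightarrow> nrm (\<lambda>x. V h b \<nu> x - V 0 b \<nu> x) \<le> \<epsilon> * nrm b"
    using almost_inv[OF \<epsilon>] by blast
  have "avg \<nu> (\<lambda>t. (ip (Y t) b)\<^sup>2) \<le> \<epsilon> * ip b b" if b: "bm b" for b
  proof -
    define E where "E = nrm f * nrm b"
    have E0: "E \<ge> 0" by (simp add: E_def nrm_nonneg)
    have coef: "\<bar>ip (Y t) (\<lambda>x. b (T g x))\<bar> \<le> E" for t g
      using ip_le_nrm[OF bY bm_T[OF b], of t g] by (simp add: E_def nY nrm_T b)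
    \<comment> \<open>One list serves all translates of \<open>b\<close> at once, because they have
      the same norm.\<close>
    have almost_inv_b: "\<exists>\<nu>. \<nu> \<noteq> [] \<and>
        (\<forall>g h. nrm (\<lambda>x. V h (\<lambda>x. b (T g x)) \<nu> x - V 0 (\<lambda>x. b (T g x)) \<nu> x) \<le> \<delta>) \<and>
        (\<forall>h. nrm (\<lambda>x. V h b \<nu> x - V 0 b \<nu> x) \<le> \<delta>)" if "\<delta> > 0" for \<delta>
    proof -
      have pos: "\<delta> / (nrm b + 1) > 0" using that nrm_nonneg[of b] by simp
      obtain \<mu> where \<mu>: "\<mu> \<noteq> []" "\<And>b' h. bm b' \<Longrightarrow>
          nrm (\<lambda>x. V h b' \<mu> x - V 0 b' \<mu> x) \<le> \<delta> / (nrm b + 1) * nrm b'"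
        using almost_inv[OF pos] by blast
      have le: "\<delta> / (nrm b + 1) * nrm b \<le> \<delta>"
        using that nrm_nonneg[of b] by (simp add: field_simps)
      then have le': "\<delta> / (nrm b + 1) * nrm (\<lambda>x. b (T g x)) \<le> \<delta>" for g by (simp add: nrm_T[OF b])
      show ?thesis
      proof (intro exI[of _ \<mu>] conjI allI \<mu>(1))
        show "nrm (\<lambda>x. V h (\<lambda>x. b (T g x)) \<mu> x - V 0 (\<lambda>x. b (T g x)) \<mu> x) \<le> \<delta>" for g h
          using order_trans[OF \<mu>(2)[OF bm_T[OF b]] le'] .
        show "nrm (\<lambda>x. V h b \<mu> x - V 0 b \<mu> x) \<le> \<delta>" for h
          using order_trans[OF \<mu>(2)[OF b] le] .
      qed
    qed
    obtain p where p: "p \<in> borel_measurable M" "\<And>x. x \<in> space M \<Longrightarrow> \<bar>p x\<bar> \<le> E * C"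
      "\<And>\<nu> \<epsilon>. \<nu> \<noteq> [] \<Longrightarrow> (\<And>h. nrm (\<lambda>x. V h b \<nu> x - V 0 b \<nu> x) \<le> \<epsilon>) \<Longrightarrow>
        nrm (\<lambda>x. V 0 b \<nu> x - p x) \<le> \<epsilon>"
    proof (rule mean_exists[of "\<lambda>t x. ip (Y t) b * Y t x" "E * C"])
      show "(\<lambda>x. ip (Y t) b * Y t x) \<in> borel_measurable M" for t
        by (intro bm_measurable bm_cmult bY)
      show "\<bar>ip (Y t) b * Y t x\<bar> \<le> E * C" if "x \<in> space M" for t x
        unfolding abs_mult using ip_le_nrm[OF bY b, of t] YC[OF that] E0
        by (intro mult_mono) (auto simp: E_def nY)
      show "\<exists>\<nu>. \<nu> \<noteq> [] \<and> (\<forall>h. nrm (\<lambda>x. avg \<nu> (\<lambda>t. ip (Y (h + t)) b * Y (h + t) x)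
          - avg \<nu> (\<lambda>t. ip (Y t) b * Y t x)) \<le> \<epsilon>)" if "\<epsilon> > 0" for \<epsilon>
        using almost_inv_b[OF that] by (auto simp: V_def)
    qed (use that in \<open>auto simp: V_def\<close>)
    have bp: "bm p" using p(1,2) by (rule bmI)
    have "ap p"
    proof (rule apI[OF bp])
      fix \<delta> :: real assume "\<delta> > 0"
      \<comment> \<open>Each of two comparisons between a translate of \<open>p\<close> and
        \<open>W\<close> costs \<open>2 * \<eta>\<close>; comparing \<open>W h\<close> with
        \<open>W h'\<close> costs \<open>\<eta>\<close>.\<close>
      define \<eta> where "\<eta> = \<delta> / 5"
      have "\<eta> > 0" using \<open>\<delta> > 0\<close> by (simp add: \<eta>_def)
      from almost_inv_b[OF this] obtain \<mu> where \<mu>: "\<mu> \<noteq> []"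
        "\<And>g h. nrm (\<lambda>x. V h (\<lambda>x. b (T g x)) \<mu> x - V 0 (\<lambda>x. b (T g x)) \<mu> x) \<le> \<eta>"
        "\<And>h. nrm (\<lambda>x. V h b \<mu> x - V 0 b \<mu> x) \<le> \<eta>"
        by blast
      define W where "W h = V 0 (\<lambda>x. b (T (\<phi> h) x)) \<mu>" for h
      have bW: "bm (W h)" for h unfolding W_def by (rule bV)
      have pW: "nrm (\<lambda>x. p (T (\<phi> h) x) - W h x) \<le> 2 * \<eta>" for h
      proof -
        \<comment> \<open>Translating the average amounts to translating \<open>b\<close> and
          shifting the index by \<open>h\<close>; almost invariance then removes the shift.\<close>
        have "V 0 b \<mu> (T (\<phi> h) x) = V h (\<lambda>x. b (T (\<phi> h) x)) \<mu> x" if x: "x \<in> space M" for x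
        proof -
          have "ip (Y (h + t)) (\<lambda>x. b (T (\<phi> h) x)) = ip (Y t) b" for t
          proof -
            have "ip (Y t) b = ip (\<lambda>x. f (T (\<phi> t) x)) (\<lambda>x. b (T 0 x))"
              unfolding Y_def by (intro ip_cong) (simp_all add: T_zero)
            also have "\<dots> = ip (Y (h + t)) (\<lambda>x. b (T (\<phi> h) x))"
              using ip_T_add[OF f b, of "\<phi> h" "\<phi> t" 0] by (simp add: Y_def \<phi>_add)
            finally show ?thesis by simp
          qed
          moreover have "Y t (T (\<phi> h) x) = Y (h + t) x" for t
            using x by (simp add: Y_def \<phi>_add T_add[symmetric] add.commute)
          ultimately show ?thesis by (simp add: V_def)
        qed
        then have "nrm (\<lambda>x. p (T (\<phi> h) x) - V h (\<lambda>x. b (T (\<phi> h) x)) \<mu> x)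
            = nrm (\<lambda>x. p (T (\<phi> h) x) - V 0 b \<mu> (T (\<phi> h) x))"
          by (intro nrm_cong) simp
        also have "\<dots> = nrm (\<lambda>x. V 0 b \<mu> x - p x)"
          using nrm_T[OF bm_diff[OF bp bV[of 0 b \<mu>]], of "\<phi> h"] nrm_minus_commute[of p] by simp
        also have "\<dots> \<le> \<eta>" by (rule p(3)[OF \<mu>(1,3)])
        finally show ?thesis
          using nrm_triangle_diff[OF bm_T[OF bp, of "\<phi> h"] bV[of h "\<lambda>x. b (T (\<phi> h) x)" \<mu>] bW[of h]]
            \<mu>(2)[of h "\<phi> h"] unfolding W_def by simp
      qed
      define \<theta> where "\<theta> = \<eta> / (nrm f + 1)"
      have "\<theta> > 0" using \<open>\<eta> > 0\<close> nrm_nonneg[of f] by (simp add: \<theta>_def)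
      define e where "e h t = ip (Y t) (\<lambda>x. b (T (\<phi> h) x))" for h t
      \<comment> \<open>All \<open>W h\<close> are averages of the same finitely many
        \<open>Y t\<close> with coefficients bounded by \<open>E\<close>; rounding these to mesh
        \<open>\<theta>\<close> leaves finitely many colours.\<close>
      define col where "col h = map (\<lambda>t. \<lfloor>e h t / \<theta>\<rfloor>) \<mu>" for h
      have "range col \<subseteq> {xs. set xs \<subseteq> {\<lfloor>- E / \<theta>\<rfloor>..\<lfloor>E / \<theta>\<rfloor>} \<and> length xs = length \<mu>}"
      proof -
        have "- E \<le> e h t \<and> e h t \<le> E" for h t
          using coef[of t "\<phi> h"] by (simp add: e_def abs_le_iff)
        then have "\<lfloor>- E / \<theta>\<rfloor> \<le> \<lfloor>e h t / \<theta>\<rfloor> \<and> \<lfloor>e h t / \<theta>\<rfloor> \<le> \<lfloor>E / \<theta>\<rfloor>" for h t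
          using \<open>\<theta> > 0\<close> by (intro conjI floor_mono divide_right_mono) auto
        then show ?thesis by (auto simp: col_def)
      qed
      then have fin_col: "finite (range col)"
        by (rule finite_subset) (intro finite_lists_length_eq finite_atLeastAtMost_int)
      have same_col: "nrm (\<lambda>x. p (T (\<phi> h) x) - p (T (\<phi> h') x)) \<le> \<delta>" if "col h = col h'" for h h'
      proof -
        have close: "\<bar>e h t - e h' t\<bar> \<le> \<theta>" if "t \<in> set \<mu>" for t
        proof -
          have "\<lfloor>e h t / \<theta>\<rfloor> = \<lfloor>e h' t / \<theta>\<rfloor>" using \<open>col h = col h'\<close> that by (simp add: col_def)
          then have "\<bar>e h t / \<theta> - e h' t / \<theta>\<bar> \<le> 1" by linarith
          then show ?thesis
            using \<open>\<theta> > 0\<close> by (simp add: diff_divide_distrib[symmetric] abs_divide)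
        qed
        have "nrm (\<lambda>x. avg \<mu> (\<lambda>t. (e h t - e h' t) * Y t x) - 0) \<le> \<eta>"
        proof (rule nrm_avg_diff_le[OF \<mu>(1) _ bm_const])
          fix t assume t: "t \<in> set \<mu>"
          show "bm (\<lambda>x. (e h t - e h' t) * Y t x)" by (intro bm_cmult bY)
          have "nrm (\<lambda>x. (e h t - e h' t) * Y t x - 0) \<le> \<theta> * nrm f"
            using close[OF t] by (simp add: nrm_cmult nY mult_right_mono nrm_nonneg)
          also have "\<dots> \<le> \<eta>" using \<open>\<eta> > 0\<close> nrm_nonneg[of f] by (simp add: \<theta>_def field_simps)
          finally show "nrm (\<lambda>x. (e h t - e h' t) * Y t x - 0) \<le> \<eta>" .
        qed
        moreover have "avg \<mu> (\<lambda>t. (e h t - e h' t) * Y t x) = W h x - W h' x" for x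
          by (simp add: W_def V_def e_def left_diff_distrib avg_diff)
        ultimately have WW: "nrm (\<lambda>x. W h x - W h' x) \<le> \<eta>" by simp
        have "nrm (\<lambda>x. p (T (\<phi> h) x) - p (T (\<phi> h') x))
            \<le> nrm (\<lambda>x. p (T (\<phi> h) x) - W h x) + nrm (\<lambda>x. W h x - p (T (\<phi> h') x))"
          by (intro nrm_triangle_diff bm_T bp bW)
        also have "nrm (\<lambda>x. W h x - p (T (\<phi> h') x))
            \<le> nrm (\<lambda>x. W h x - W h' x) + nrm (\<lambda>x. W h' x - p (T (\<phi> h') x))"
          by (intro nrm_triangle_diff bm_T bp bW)
        finally show ?thesis
          using WW pW[of h] pW[of h'] nrm_minus_commute[of "W h'"] by (simp add: \<eta>_def)
      qed
      \<comment> \<open>Coset representatives extend the colouring to the whole group: a common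
        representative acts isometrically and drops out.\<close>
      obtain \<rho> \<sigma> where \<rho>: "\<And>g. \<rho> g \<in> R" "\<And>g. g = \<rho> g + \<phi> (\<sigma> g)" using R(2) by metis
      have "finite (range \<rho>)" using \<rho>(1) by (intro finite_subset[OF _ R(1)]) auto
      moreover have "finite (range (\<lambda>g. col (\<sigma> g)))" by (rule finite_subset[OF _ fin_col]) auto
      ultimately have "finite (range (\<lambda>g. (\<rho> g, col (\<sigma> g))))" by (rule finite_range_Pair)
      moreover have "nrm (\<lambda>x. p (T g x) - p (T h x)) \<le> \<delta>"
        if "(\<rho> g, col (\<sigma> g)) = (\<rho> h, col (\<sigma> h))" for g h
      proof -
        have "nrm (\<lambda>x. p (T g x) - p (T h x))
            = nrm (\<lambda>x. p (T (\<rho> g + \<phi> (\<sigma> g)) x) - p (T (\<rho> g + \<phi> (\<sigma> h)) x))"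
          using \<rho>(2)[of g] \<rho>(2)[of h] that by simp
        also have "\<dots> \<le> \<delta>" unfolding nrm_T_add[OF bp] using that by (intro same_col) simp
        finally show ?thesis .
      qed
      ultimately show "\<exists>c :: 'g \<Rightarrow> 'g \<times> int list. finite (range c) \<and>
          (\<forall>g h. c g = c h \<longrightarrow> nrm (\<lambda>x. p (T g x) - p (T h x)) \<le> \<delta>)"
        by (intro exI[of _ "\<lambda>g. (\<rho> g, col (\<sigma> g))"]) blast
    qed
    have "ip (Y t) p = 0" for t
    proof -
      have "ip (Y t) p = ip (\<lambda>x. f (T (\<phi> t + 0) x)) (\<lambda>x. p (T (\<phi> t + (- \<phi> t)) x))"
        unfolding Y_def by (intro ip_cong) (simp_all add: T_zero)
      also have "\<dots> = ip (\<lambda>x. f (T 0 x)) (\<lambda>x. p (T (- \<phi> t) x))" by (rule ip_T_add[OF f bp])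
      also have "\<dots> = ip f (\<lambda>x. p (T (- \<phi> t) x))" by (intro ip_cong) (simp_all add: T_zero)
      also have "\<dots> = 0" by (intro orth ap_T \<open>ap p\<close>)
      finally show ?thesis .
    qed
    then have Vp: "ip (V 0 b \<mu>) p = 0" for \<mu> by (simp add: ip_V[OF bp] avg_def)
    \<comment> \<open>\<open>p\<close> is orthogonal to every \<open>V 0 b \<mu>\<close>, yet these
      come arbitrarily close to \<open>p\<close> in norm.\<close>
    have p0: "nrm p = 0"
    proof (rule ccontr)
      assume "nrm p \<noteq> 0"
      then have pos: "nrm p > 0" using nrm_nonneg[of p] by simp
      then have "nrm p / 2 > 0" by simp
      from almost_inv_b[OF this] obtain \<mu> where \<mu>: "\<mu> \<noteq> []" "\<And>h. nrm (\<lambda>x. V h b \<mu> x - V 0 b \<mu> x) \<le> nrm p / 2"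
        by blast
      have "(nrm p)\<^sup>2 = - ip (\<lambda>x. V 0 b \<mu> x - p x) p"
        by (simp add: ip_diff_left bV bp Vp nrm_square)
      also have "\<dots> \<le> nrm (\<lambda>x. V 0 b \<mu> x - p x) * nrm p"
        using ip_le_nrm[OF bm_diff[OF bV bp] bp, of 0 b \<mu>] by simp
      also have "\<dots> \<le> nrm p / 2 * nrm p"
        using p(3)[OF \<mu>] by (intro mult_right_mono nrm_nonneg)
      finally show False using pos by (simp add: power2_eq_square)
    qed
    have "nrm (V 0 b \<nu>) \<le> nrm (\<lambda>x. V 0 b \<nu> x - p x) + nrm p"
      using nrm_triangle[OF bm_diff[OF bV bp] bp, of 0 b \<nu>] by simp
    also have "\<dots> \<le> \<epsilon> * nrm b" using p(3)[OF \<nu>(1) \<nu>(2)[OF b]] p0 by simp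
    finally have "nrm (V 0 b \<nu>) \<le> \<epsilon> * nrm b" .
    have "avg \<nu> (\<lambda>t. (ip (Y t) b)\<^sup>2) = ip (V 0 b \<nu>) b"
      by (simp add: ip_V[OF b] power2_eq_square)
    also have "\<dots> \<le> nrm (V 0 b \<nu>) * nrm b" using ip_le_nrm[OF bV b, of 0 b \<nu>] by simp
    also have "\<dots> \<le> \<epsilon> * nrm b * nrm b"
      using \<open>nrm (V 0 b \<nu>) \<le> \<epsilon> * nrm b\<close> by (intro mult_right_mono nrm_nonneg)
    also have "\<dots> = \<epsilon> * ip b b" by (simp add: nrm_square[symmetric] power2_eq_square)
    finally show ?thesis .
  qed
  then show ?thesis using \<nu>(1) unfolding Y_def by blast
qed

end

section \<open>Ergodicity along finite-index subgroups\<close>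

locale ergodic_mps = mps M T for M :: "'x measure" and T :: "'g::{ab_group_add, countable} \<Rightarrow> 'x \<Rightarrow> 'x" +
  assumes ergodic: "A \<in> sets M \<Longrightarrow> (\<And>g. T g -` A \<inter> space M = A) \<Longrightarrow> prob A = 0 \<or> prob A = 1"
begin

text \<open>The points whose whole orbit lies in \<open>E\<close> form a strictly invariant set;
  since the group is countable, it is measurable and differs from \<open>E\<close> by a null
  set.\<close>

lemma ergodic_AE:
  assumes E [measurable]: "E \<in> sets M" and inv: "\<And>g. AE x in M. T g x \<in> E \<longleftrightarrow> x \<in> E"
  shows "prob E = 0 \<or> prob E = 1"
proof -
  define E' where "E' = {x \<in> space M. \<forall>g. T g x \<in> E}"
  have E' [measurable]: "E' \<in> sets M" unfolding E'_def by measurable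
  have "T g -` E' \<inter> space M = E'" for g
  proof -
    have "(\<forall>h. T h (T g x) \<in> E) \<longleftrightarrow> (\<forall>h. T h x \<in> E)" if x: "x \<in> space M" for x
    proof -
      have "(\<forall>h. T h (T g x) \<in> E) \<longleftrightarrow> (\<forall>h. T (h + g) x \<in> E)" using x by (simp add: T_add)
      also have "\<dots> \<longleftrightarrow> (\<forall>h. T h x \<in> E)" by (metis diff_add_cancel)
      finally show ?thesis .
    qed
    then show ?thesis unfolding E'_def using T_space by auto
  qed
  then have "prob E' = 0 \<or> prob E' = 1" by (intro ergodic E')
  moreover have "prob E = prob E'"
  proof (rule measure_eq_AE)
    have "AE x in M. \<forall>g. T g x \<in> E \<longleftrightarrow> x \<in> E" using inv by (simp add: AE_all_countable)
    then show "AE x in M. x \<in> E \<longleftrightarrow> x \<in> E'" by (rule AE_mp) (auto simp: E'_def)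
  qed measurable
  ultimately show ?thesis by simp
qed

text \<open>The sets invariant under \<open>\<theta>(G)\<close> form, up to null sets, a finite algebra: each of positive
  measure has measure at least \<open>1 / card R\<close>. Hence there is an atom \<open>B\<close>, its translates by \<open>R\<close>
  cover the space, and invariant functions are constant on each of these translates.\<close>
lemma finite_index_invariant_rank:
  assumes hom: "additive_hom \<theta>" and R: "finite R" "\<And>g. \<exists>r\<in>R. \<exists>h. g = r + \<theta> h"
  obtains e :: "'g \<Rightarrow> 'x \<Rightarrow> real" where "\<And>r. e r \<in> borel_measurable M"
    "\<And>r x. x \<in> space M \<Longrightarrow> \<bar>e r x\<bar> \<le> 1"
    "\<And>p C F. p \<in> borel_measurable M \<Longrightarrow> (\<And>x. x \<in> space M \<Longrightarrow> \<bar>p x\<bar> \<le> C) \<Longrightarrow>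
      (\<And>g. AE x in M. p (T (\<theta> g) x) = p x) \<Longrightarrow> bm F \<Longrightarrow>
      \<bar>ip F p\<bar> \<le> C * (\<Sum>r\<in>R. \<bar>ip F (e r)\<bar>)"
proof -
  define inv where "inv B \<longleftrightarrow> B \<in> sets M \<and> (\<forall>g. AE x in M. T (\<theta> g) x \<in> B \<longleftrightarrow> x \<in> B)" for B
  have Rne: "R \<noteq> {}" using R(2)[of 0] by blast
  have cover: "(AE x in M. \<exists>r\<in>R. T r x \<in> B) \<and> 1 \<le> card R * prob B"
    if B: "inv B" "prob B > 0" for B
  proof -
    have [measurable]: "B \<in> sets M" using B(1) by (simp add: inv_def)
    define E where "E = {x \<in> space M. \<exists>r\<in>R. T r x \<in> B}"
    have E [measurable]: "E \<in> sets M" unfolding E_def using R(1) by measurable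
    have step: "AE x in M. T g x \<in> E \<longrightarrow> x \<in> E" for g
    proof -
      have "AE x in M. T r (T g x) \<in> B \<longrightarrow> x \<in> E" if r: "r \<in> R" for r
      proof -
        \<comment> \<open>Rewriting \<open>r + g\<close> through a coset representative leaves a
          motion by \<theta>(G), which does not affect membership in \<open>B\<close> outside a null
          set.\<close>
        obtain r' h where r': "r' \<in> R" "r + g = r' + \<theta> h" using R(2)[of "r + g"] by blast
        have "AE x in M. T (\<theta> h) x \<in> B \<longleftrightarrow> x \<in> B" using B(1) by (simp add: inv_def)
        then have "AE x in M. T (\<theta> h) (T r' x) \<in> B \<longleftrightarrow> T r' x \<in> B" by (rule AE_T)
        then show ?thesis
        proof (rule AE_mp, intro AE_I2 impI)
          fix x assume x: "x \<in> space M" "T (\<theta> h) (T r' x) \<in> B \<longleftrightarrow> T r' x \<in> B" "T r (T g x) \<in> B"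
          have "T r (T g x) = T (\<theta> h) (T r' x)"
            using x(1) r'(2) by (simp add: T_add[symmetric] add.commute)
          then show "x \<in> E" using x r'(1) by (auto simp: E_def)
        qed
      qed
      then have "AE x in M. \<forall>r\<in>R. T r (T g x) \<in> B \<longrightarrow> x \<in> E"
        by (subst AE_finite_all[OF R(1)]) auto
      then show ?thesis by (rule AE_mp) (auto simp: E_def)
    qed
    have "AE x in M. T g x \<in> E \<longleftrightarrow> x \<in> E" for g
    proof -
      have "AE x in M. T (- g) (T g x) \<in> E \<longrightarrow> T g x \<in> E" using AE_T[OF step[of "- g"]] .
      then show ?thesis using step[of g]
      proof (eventually_elim)
        case (elim x)
        show ?case
        proof (cases "x \<in> space M")
          case True
          then have "T (- g) (T g x) = x" by (simp add: T_add[symmetric] T_zero)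
          then show ?thesis using elim by auto
        next
          case False
          have "T g x \<notin> E \<or> T g x \<in> E" by simp
          then show ?thesis using elim False by (auto simp: E_def)
        qed
      qed
    qed
    then have "prob E = 0 \<or> prob E = 1" by (rule ergodic_AE[OF E])
    have TB: "prob (T r -` B \<inter> space M) = prob B" for r
      using measure_distr[OF T_measurable, of B r] by (simp add: T_distr)
    obtain r where "r \<in> R" using Rne by blast
    then have "T r -` B \<inter> space M \<subseteq> E" by (auto simp: E_def)
    then have "prob B \<le> prob E" using finite_measure_mono[of "T r -` B \<inter> space M" E] TB by simp
    with \<open>prob E = 0 \<or> prob E = 1\<close> B(2) have E1: "prob E = 1" by linarith
    have "E = (\<Union>r\<in>R. T r -` B \<inter> space M)" by (auto simp: E_def)
    then have "prob E \<le> (\<Sum>r\<in>R. prob (T r -` B \<inter> space M))"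
      using finite_measure_subadditive_finite[OF R(1), of "\<lambda>r. T r -` B \<inter> space M"]
      by (simp add: image_subset_iff)
    then have "1 \<le> card R * prob B" by (simp add: E1 TB)
    moreover have "AE x in M. x \<in> E" using E1 by (simp add: prob_eq_1)
    then have "AE x in M. \<exists>r\<in>R. T r x \<in> B" by (rule AE_mp) (auto simp: E_def)
    ultimately show ?thesis by simp
  qed
  have inv_Int: "inv (B \<inter> C)" and inv_Diff: "inv (B - C)" if "inv B" "inv C" for B C
  proof -
    have "(AE x in M. T (\<theta> g) x \<in> B \<inter> C \<longleftrightarrow> x \<in> B \<inter> C) \<and>
        (AE x in M. T (\<theta> g) x \<in> B - C \<longleftrightarrow> x \<in> B - C)" for g
    proof -
      have "AE x in M. T (\<theta> g) x \<in> B \<longleftrightarrow> x \<in> B" "AE x in M. T (\<theta> g) x \<in> C \<longleftrightarrow> x \<in> C"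
        using that by (simp_all add: inv_def)
      then have "AE x in M. (T (\<theta> g) x \<in> B \<longleftrightarrow> x \<in> B) \<and> (T (\<theta> g) x \<in> C \<longleftrightarrow> x \<in> C)"
        by (rule AE_conjI)
      then show ?thesis by (intro conjI; elim AE_mp; intro AE_I2 impI; simp)
    qed
    then show "inv (B \<inter> C)" "inv (B - C)" using that unfolding inv_def by auto
  qed
  define m where "m = Inf (prob ` {B. inv B \<and> prob B > 0})"
  have "inv (space M)" unfolding inv_def using T_space by auto
  then have ne: "prob ` {B. inv B \<and> prob B > 0} \<noteq> {}" by (auto simp: prob_space intro!: exI[of _ "space M"])
  have cR: "real (card R) > 0" using R(1) Rne by (simp add: card_gt_0_iff)
  have lb: "1 / card R \<le> prob B" if "inv B" "prob B > 0" for B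
    using cover[OF that] cR by (simp add: field_simps)
  have bb: "bdd_below (prob ` {B. inv B \<and> prob B > 0})" by (auto intro!: bdd_belowI[of _ 0])
  have m_le: "m \<le> prob B" if "inv B" "prob B > 0" for B
    unfolding m_def using that by (intro cInf_lower bb) auto
  have "1 / card R \<le> m" unfolding m_def using ne lb by (intro cInf_greatest) auto
  then have "m > 0" using cR less_le_trans[of 0 "1 / real (card R)" m] by simp
  \<comment> \<open>Two disjoint invariant parts of positive measure would have measure at least
    \<open>m\<close> each, so a set of measure below \<open>2 * m\<close> cannot be split.\<close>
  have "\<exists>y\<in>prob ` {B. inv B \<and> prob B > 0}. y < 2 * m"
    using \<open>m > 0\<close> ne bb by (subst cInf_less_iff[symmetric]) (auto simp: m_def[symmetric])
  then obtain B where B: "inv B" "prob B > 0" "prob B < 2 * m" by auto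
  have B_meas [measurable]: "B \<in> sets M" using B(1) by (simp add: inv_def)
  have atom: "prob (B \<inter> C) = 0 \<or> prob (B - C) = 0" if C: "inv C" for C
  proof (rule ccontr)
    assume "\<not> ?thesis"
    then have "prob (B \<inter> C) > 0" "prob (B - C) > 0" by (auto simp: zero_less_measure_iff)
    then have "m \<le> prob (B \<inter> C)" "m \<le> prob (B - C)"
      using m_le inv_Int[OF B(1) C] inv_Diff[OF B(1) C] by auto
    moreover have "prob B = prob (B \<inter> C) + prob (B - C)"
      using C finite_measure_Union'[of "B \<inter> C" B] unfolding inv_def
      by (subst finite_measure_Diff') (auto simp: B_meas)
    ultimately show False using B(3) by simp
  qed
  have const: "\<exists>c. \<bar>c\<bar> \<le> C \<and> (AE x in M. x \<in> B \<longrightarrow> q x = c)"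
    if q [measurable]: "q \<in> borel_measurable M" and qC: "\<And>x. x \<in> space M \<Longrightarrow> \<bar>q x\<bar> \<le> C"
      and q_inv: "\<And>g. AE x in M. q (T (\<theta> g) x) = q x" for q :: "'x \<Rightarrow> real" and C
  proof -
    have bq: "bm q" using q qC by (rule bmI)
    have b1: "bm (indicat_real B)" using B_meas by (rule bm_indicator)
    define c where "c = ip (indicat_real B) q / prob B"
    have ip1: "ip (indicat_real B) (\<lambda>x. 1) = prob B" by (simp add: ip_def)
    have "\<bar>ip (indicat_real B) q\<bar> \<le> C * prob B"
    proof -
      have "\<bar>ip (indicat_real B) q\<bar> \<le> (\<integral>x. \<bar>indicat_real B x * q x\<bar> \<partial>M)"
        unfolding ip_def by (rule integral_abs_bound)
      also have "\<dots> \<le> (\<integral>x. C * indicat_real B x \<partial>M)"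
        using qC by (intro integral_mono integrable_abs ip_integrable b1 bq integrable_mult_right bm_integrable)
          (auto simp: indicator_def)
      finally show ?thesis by simp
    qed
    then have cC: "\<bar>c\<bar> \<le> C" using B(2) by (simp add: c_def field_simps)
    have zero: "(\<integral>x. indicat_real B x * (q x - c) \<partial>M) = 0"
      using ip_diff_right[OF bq bm_const[of c] b1] ip_cmult_right[of "indicat_real B" c "\<lambda>x. 1"] B(2)
      by (simp add: ip1 c_def) (simp add: ip_def)
    \<comment> \<open>The invariant set where \<open>q\<close> exceeds its mean \<open>c\<close>
      over \<open>B\<close> is null or full in the atom; either way \<open>q - c\<close> has one
      sign on \<open>B\<close> and integral zero there.\<close>
    define D where "D = {x \<in> space M. q x > c}"
    have D [measurable]: "D \<in> sets M" unfolding D_def by measurable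
    have "AE x in M. T (\<theta> g) x \<in> D \<longleftrightarrow> x \<in> D" for g
      using q_inv[of g] by (rule AE_mp) (auto simp: D_def T_space)
    then have "inv D" by (simp add: inv_def D)
    from atom[OF this] have "AE x in M. x \<in> B \<longrightarrow> q x = c"
    proof
      assume "prob (B \<inter> D) = 0"
      then have "AE x in M. x \<notin> B \<inter> D" using prob_eq_0[of "B \<inter> D"] by simp
      then have "AE x in M. 0 \<le> - (indicat_real B x * (q x - c))"
        by (rule AE_mp) (auto simp: D_def indicator_def)
      moreover have "integrable M (\<lambda>x. - (indicat_real B x * (q x - c)))"
        using b1 bq by (intro integrable_minus ip_integrable bm_diff bm_const)
      ultimately have "AE x in M. - (indicat_real B x * (q x - c)) = 0"
        using zero by (subst integral_nonneg_eq_0_iff_AE[symmetric]) auto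
      then show ?thesis by (rule AE_mp) (auto simp: indicator_def)
    next
      assume "prob (B - D) = 0"
      then have "AE x in M. x \<notin> B - D" using prob_eq_0[of "B - D"] by simp
      then have "AE x in M. 0 \<le> indicat_real B x * (q x - c)"
        by (rule AE_mp) (auto simp: D_def indicator_def)
      moreover have "integrable M (\<lambda>x. indicat_real B x * (q x - c))"
        using b1 bq by (intro ip_integrable bm_diff bm_const)
      ultimately have "AE x in M. indicat_real B x * (q x - c) = 0"
        using zero by (subst integral_nonneg_eq_0_iff_AE[symmetric]) auto
      then show ?thesis by (rule AE_mp) (auto simp: indicator_def)
    qed
    then show ?thesis using cC by blast
  qed
  \<comment> \<open>The translates of \<open>B\<close> may overlap; dividing by the number of those
    that contain the point makes the \<open>e r\<close> a partition of unity almost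
    everywhere.\<close>
  define N where "N x = (\<Sum>s\<in>R. indicat_real B (T s x))" for x
  define e where "e r x = (if r \<in> R then indicat_real B (T r x) / N x else 0)" for r x
  have e_meas [measurable]: "e r \<in> borel_measurable M" for r
    unfolding e_def N_def by measurable
  have N_ge: "indicat_real B (T r x) \<le> N x" if "r \<in> R" for r x
    unfolding N_def using that R(1) by (intro member_le_sum) auto
  have e_le: "\<bar>e r x\<bar> \<le> 1" for r x
    using N_ge[of r x] unfolding e_def indicator_def by auto
  have be: "bm (e r)" for r using e_meas e_le by (rule bmI)
  have rank: "\<bar>ip F p\<bar> \<le> C * (\<Sum>r\<in>R. \<bar>ip F (e r)\<bar>)"
    if p: "p \<in> borel_measurable M" "\<And>x. x \<in> space M \<Longrightarrow> \<bar>p x\<bar> \<le> C"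
      and p_inv: "\<And>g. AE x in M. p (T (\<theta> g) x) = p x" and F: "bm F" for p C F
  proof -
    note [measurable] = p(1) bm_measurable[OF F]
    have bp: "bm p" using p by (rule bmI)
    have "\<exists>c. \<bar>c\<bar> \<le> C \<and> (AE x in M. T r x \<in> B \<longrightarrow> p x = c)" for r
    proof -
      \<comment> \<open>Translating by \<open>- r\<close> preserves invariance because the group is
        abelian, so the translate is constant on the atom.\<close>
      have "AE x in M. p (T (- r) (T (\<theta> g) x)) = p (T (- r) x)" for g
        using AE_T[OF p_inv[of g], of "- r"]
        by (rule AE_mp) (auto simp: T_add[symmetric] add.commute)
      then obtain c where c: "\<bar>c\<bar> \<le> C" "AE x in M. x \<in> B \<longrightarrow> p (T (- r) x) = c"
        using const[of "\<lambda>x. p (T (- r) x)" C] p(2) T_space by auto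
      have "AE x in M. T r x \<in> B \<longrightarrow> p x = c"
        using AE_T[OF c(2), of r] by (rule AE_mp) (auto simp: T_add[symmetric] T_zero)
      with c(1) show ?thesis by blast
    qed
    then obtain c where c: "\<And>r. \<bar>c r\<bar> \<le> C" "\<And>r. AE x in M. T r x \<in> B \<longrightarrow> p x = c r" by metis
    have "AE x in M. \<forall>r\<in>R. T r x \<in> B \<longrightarrow> p x = c r"
      using c(2) by (subst AE_finite_all[OF R(1)]) auto
    moreover have "AE x in M. \<exists>r\<in>R. T r x \<in> B" using cover[OF B(1,2)] by simp
    ultimately have "AE x in M. F x * p x = (\<Sum>r\<in>R. c r * (F x * e r x))"
    proof eventually_elim
      case (elim x)
      then obtain r where r: "r \<in> R" "T r x \<in> B" by blast
      then have "N x > 0" using N_ge[OF r(1), of x] by simp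
      have "(\<Sum>r\<in>R. c r * (F x * e r x)) = (\<Sum>r\<in>R. p x * F x * (indicat_real B (T r x) / N x))"
        using elim by (intro sum.cong) (auto simp: e_def indicator_def)
      also have "\<dots> = p x * F x * (N x / N x)"
        by (simp add: N_def sum_distrib_left[symmetric] sum_divide_distrib[symmetric])
      also have "\<dots> = F x * p x" using \<open>N x > 0\<close> by simp
      finally show ?case by simp
    qed
    then have "ip F p = (\<integral>x. (\<Sum>r\<in>R. c r * (F x * e r x)) \<partial>M)"
      unfolding ip_def by (intro integral_cong_AE) measurable
    also have "\<dots> = (\<Sum>r\<in>R. c r * ip F (e r))"
      unfolding ip_def using F be by (subst Bochner_Integration.integral_sum) (auto intro: ip_integrable)
    also have "\<bar>\<dots>\<bar> \<le> (\<Sum>r\<in>R. C * \<bar>ip F (e r)\<bar>)"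
      by (rule order_trans[OF sum_abs], rule sum_mono) (auto simp: abs_mult intro!: mult_right_mono c(1))
    finally show ?thesis by (simp add: sum_distrib_left)
  qed
  show ?thesis by (rule that[of e, OF e_meas e_le rank])
qed

end

section \<open>The weighted van der Corput estimate\<close>

context mps
begin

text \<open>Von Neumann's theorem along \<theta>(G): the correlations of the orbit form an even
  bounded function, whose almost invariant lists have almost invariant averages. The limit is the
  same for all translates of the list, hence the conclusion in terms of
  \<open>mean_zero\<close>.\<close>

lemma mean_ergodic:
  assumes hom: "additive_hom \<theta>" and F: "F \<in> borel_measurable M" "\<And>x. x \<in> space M \<Longrightarrow> \<bar>F x\<bar> \<le> C"
  obtains p where "p \<in> borel_measurable M" "\<And>x. x \<in> space M \<Longrightarrow> \<bar>p x\<bar> \<le> C"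
    "\<And>g. AE x in M. p (T (\<theta> g) x) = p x"
    "\<And>E. bm E \<Longrightarrow> mean_zero (\<lambda>g. ip E (\<lambda>x. F (T (\<theta> g) x)) - ip E p)"
proof -
  have \<theta>_add: "\<theta> (s + t) = \<theta> s + \<theta> t" for s t using hom by (simp add: additive_hom_def)
  have bF: "bm F" using F by (rule bmI)
  define y where "y t = (\<lambda>x. F (T (\<theta> t) x))" for t
  have ybm: "bm (y t)" for t unfolding y_def using bF by (rule bm_T)
  define V where "V h \<nu> x = avg \<nu> (\<lambda>t. y (h + t) x)" for h \<nu> x
  have bV: "bm (V h \<nu>)" for h \<nu> unfolding V_def by (intro bm_avg ybm)
  define \<kappa> where "\<kappa> g = ip (y g) (y 0)" for g
  have \<kappa>: "ip (y t) (y s) = \<kappa> (t - s)" for t s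
    using ip_T_add[OF bF bF, of "\<theta> s" "\<theta> (t - s)" "\<theta> 0"]
    by (simp add: \<kappa>_def y_def \<theta>_add[symmetric])
  have \<kappa>_even: "\<kappa> (- g) = \<kappa> g" for g
    using \<kappa>[of 0 g] \<kappa>[of g 0] by (simp add: ip_commute)
  have \<kappa>_bdd: "\<bar>\<kappa> g\<bar> \<le> nrm F * nrm F" for g
    using ip_le_nrm[OF ybm ybm, of g 0] by (simp add: \<kappa>_def y_def nrm_T[OF bF])
  have ipV: "ip (V h \<nu>) (V h' \<nu>) = avg \<nu> (\<lambda>t. avg \<nu> (\<lambda>s. \<kappa> (h + t - (h' + s))))" for h h' \<nu>
  proof -
    have "ip (y t) (V h' \<nu>) = avg \<nu> (\<lambda>s. \<kappa> (t - (h' + s)))" for t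
      unfolding \<kappa>[symmetric] ip_commute[of "y t"] V_def by (rule ip_avg_left[OF ybm ybm])
    moreover have "V h \<nu> = (\<lambda>x. avg \<nu> (\<lambda>t. y (h + t) x))" by (simp add: V_def fun_eq_iff)
    ultimately show ?thesis
      using ip_avg_left[OF ybm bV, of \<nu> "\<lambda>t. h + t" h' \<nu>] by simp
  qed
  have good: "\<exists>\<nu>. \<nu> \<noteq> [] \<and> (\<forall>h. nrm (\<lambda>x. V h \<nu> x - V 0 \<nu> x) \<le> \<delta>)" if "\<delta> > 0" for \<delta>
  proof -
    have "\<delta>\<^sup>2 / 2 > 0" using that by simp
    then obtain \<nu> where \<nu>: "\<nu> \<noteq> []" "\<And>h. avg \<nu> (\<lambda>t. avg \<nu> (\<lambda>s. \<kappa> (t - s)))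
        - avg \<nu> (\<lambda>t. avg \<nu> (\<lambda>s. \<kappa> (h + t - s))) \<le> \<delta>\<^sup>2 / 2"
      using almost_invariant_list[of \<kappa>, OF \<kappa>_bdd \<kappa>_even] by meson
    have "nrm (\<lambda>x. V h \<nu> x - V 0 \<nu> x) \<le> \<delta>" for h
    proof (rule power2_le_imp_le)
      have "(nrm (\<lambda>x. V h \<nu> x - V 0 \<nu> x))\<^sup>2
          = ip (V h \<nu>) (V h \<nu>) - ip (V h \<nu>) (V 0 \<nu>) - (ip (V h \<nu>) (V 0 \<nu>) - ip (V 0 \<nu>) (V 0 \<nu>))"
        unfolding nrm_square
        by (simp only: ip_diff_left ip_diff_right bm_diff bV ip_commute[of "V 0 \<nu>" "V h \<nu>"])
      also have "\<dots> = 2 * (avg \<nu> (\<lambda>t. avg \<nu> (\<lambda>s. \<kappa> (t - s)))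
          - avg \<nu> (\<lambda>t. avg \<nu> (\<lambda>s. \<kappa> (h + t - s))))"
        unfolding ipV by simp
      also have "\<dots> \<le> \<delta>\<^sup>2" using \<nu>(2)[of h] by simp
      finally show "(nrm (\<lambda>x. V h \<nu> x - V 0 \<nu> x))\<^sup>2 \<le> \<delta>\<^sup>2" .
    qed (use that in simp)
    then show ?thesis using \<nu>(1) by blast
  qed
  obtain p where p: "p \<in> borel_measurable M" "\<And>x. x \<in> space M \<Longrightarrow> \<bar>p x\<bar> \<le> C"
    "\<And>\<nu> \<epsilon>. \<nu> \<noteq> [] \<Longrightarrow> (\<And>h. nrm (\<lambda>x. V h \<nu> x - V 0 \<nu> x) \<le> \<epsilon>) \<Longrightarrow>
      nrm (\<lambda>x. V 0 \<nu> x - p x) \<le> \<epsilon>"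
  proof (rule mean_exists[of y C])
    show "y t \<in> borel_measurable M" for t by (intro bm_measurable ybm)
    show "\<bar>y t x\<bar> \<le> C" if "x \<in> space M" for t x using F(2) T_space[OF that] by (simp add: y_def)
    show "\<exists>\<nu>. \<nu> \<noteq> [] \<and> (\<forall>h. nrm (\<lambda>x. avg \<nu> (\<lambda>t. y (h + t) x) - avg \<nu> (\<lambda>t. y t x)) \<le> \<epsilon>)"
      if "\<epsilon> > 0" for \<epsilon> using good[OF that] by (simp add: V_def)
  qed (use that in \<open>auto simp: V_def\<close>)
  have bp: "bm p" using p(1,2) by (rule bmI)
  have Vp: "\<exists>\<nu>. \<nu> \<noteq> [] \<and> (\<forall>h. nrm (\<lambda>x. V h \<nu> x - p x) \<le> \<delta>)" if "\<delta> > 0" for \<delta>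
  proof -
    have "\<delta> / 2 > 0" using that by simp
    from good[OF this] obtain \<nu> where \<nu>: "\<nu> \<noteq> []" "\<And>h. nrm (\<lambda>x. V h \<nu> x - V 0 \<nu> x) \<le> \<delta> / 2" by blast
    have "nrm (\<lambda>x. V h \<nu> x - p x) \<le> \<delta>" for h
      using nrm_triangle_diff[OF bV[of h \<nu>] bV[of 0 \<nu>] bp] \<nu>(2)[of h] p(3)[OF \<nu>] by simp
    then show ?thesis using \<nu>(1) by blast
  qed
  have "AE x in M. p (T (\<theta> g) x) = p x" for g
  proof -
    have b: "bm (\<lambda>x. p (T (\<theta> g) x) - p x)" by (intro bm_diff bm_T bp)
    have "nrm (\<lambda>x. p (T (\<theta> g) x) - p x) \<le> 0"
    proof (rule field_le_epsilon)
      fix \<delta> :: real assume "\<delta> > 0"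
      then have "\<delta> / 2 > 0" by simp
      from Vp[OF this] obtain \<nu> where \<nu>: "\<nu> \<noteq> []" "\<And>h. nrm (\<lambda>x. V h \<nu> x - p x) \<le> \<delta> / 2" by blast
      have "V 0 \<nu> (T (\<theta> g) x) = V g \<nu> x" if "x \<in> space M" for x
        using that by (simp add: V_def y_def \<theta>_add T_add[symmetric] add.commute)
      then have "nrm (\<lambda>x. p (T (\<theta> g) x) - V g \<nu> x) = nrm (\<lambda>x. p (T (\<theta> g) x) - V 0 \<nu> (T (\<theta> g) x))"
        by (intro nrm_cong) simp
      also have "\<dots> = nrm (\<lambda>x. V 0 \<nu> x - p x)"
        using nrm_T[OF bm_diff[OF bp bV[of 0 \<nu>]], of "\<theta> g"] nrm_minus_commute[of p] by simp
      also have "\<dots> \<le> \<delta> / 2" by (rule \<nu>(2))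
      finally show "nrm (\<lambda>x. p (T (\<theta> g) x) - p x) \<le> 0 + \<delta>"
        using nrm_triangle_diff[OF bm_T[OF bp, of "\<theta> g"] bV[of g \<nu>] bp] \<nu>(2)[of g] by simp
    qed
    then have "nrm (\<lambda>x. p (T (\<theta> g) x) - p x) = 0" using nrm_nonneg[of "\<lambda>x. p (T (\<theta> g) x) - p x"] by simp
    then have "(\<integral>x. (p (T (\<theta> g) x) - p x) * (p (T (\<theta> g) x) - p x) \<partial>M) = 0"
      by (simp add: nrm_def ip_def)
    then have "AE x in M. (p (T (\<theta> g) x) - p x) * (p (T (\<theta> g) x) - p x) = 0"
      using ip_integrable[OF b b] by (subst integral_nonneg_eq_0_iff_AE[symmetric]) auto
    then show ?thesis by simp
  qed
  moreover have "mean_zero (\<lambda>g. ip E (\<lambda>x. F (T (\<theta> g) x)) - ip E p)" if E: "bm E" for E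
    unfolding mean_zero_def
  proof (intro allI impI)
    fix \<epsilon> :: real assume "\<epsilon> > 0"
    then have "\<epsilon> / (nrm E + 1) > 0" using nrm_nonneg[of E] by simp
    from Vp[OF this] obtain \<nu> where \<nu>: "\<nu> \<noteq> []" "\<And>h. nrm (\<lambda>x. V h \<nu> x - p x) \<le> \<epsilon> / (nrm E + 1)" by blast
    have "\<bar>avg \<nu> (\<lambda>t. ip E (\<lambda>z. F (T (\<theta> (x + t)) z)) - ip E p)\<bar> \<le> \<epsilon>" for x
    proof -
      have "avg \<nu> (\<lambda>t. ip E (\<lambda>z. F (T (\<theta> (x + t)) z)) - ip E p) = avg \<nu> (\<lambda>t. ip (y (x + t)) E) - ip E p"
        by (simp add: avg_diff avg_const[OF \<nu>(1)] y_def ip_commute[of E])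
      also have "\<dots> = ip (\<lambda>z. V x \<nu> z - p z) E"
        unfolding ip_diff_left[OF bV bp E] unfolding V_def
        by (subst ip_avg_left) (auto simp: ybm E ip_commute[of E])
      also have "\<bar>\<dots>\<bar> \<le> nrm (\<lambda>z. V x \<nu> z - p z) * nrm E"
        by (intro ip_le_nrm bm_diff bV bp E)
      also have "\<dots> \<le> \<epsilon> / (nrm E + 1) * nrm E" by (intro mult_right_mono \<nu>(2) nrm_nonneg)
      also have "\<dots> \<le> \<epsilon>" using \<open>\<epsilon> > 0\<close> nrm_nonneg[of E] by (simp add: field_simps)
      finally show ?thesis .
    qed
    then show "\<exists>\<nu>. \<nu> \<noteq> [] \<and> (\<forall>x. \<bar>avg \<nu> (\<lambda>t. ip E (\<lambda>z. F (T (\<theta> (x + t)) z)) - ip E p)\<bar> \<le> \<epsilon>)"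
      using \<nu>(1) by blast
  qed
  ultimately show ?thesis by (intro that[of p] p(1,2))
qed

end

context ergodic_mps
begin

text \<open>Van der Corput's argument. A weight \<open>w\<close> of positive type costs nothing: it is a matrix
  coefficient of a unitary representation, so in the correlations of the weighted sequence it only
  contributes the factor \<open>w (h - h')\<close>, which does not depend on the averaging variable.\<close>
lemma weighted_van_der_Corput:
  fixes \<phi> \<psi> :: "'g \<Rightarrow> 'g" and w :: "'g \<Rightarrow> real"
  assumes hom: "additive_hom \<phi>" "additive_hom \<psi>"
    and R: "finite R" "\<And>g. \<exists>r\<in>R. \<exists>h. g = r + (\<psi> h - \<phi> h)"
    and f0: "f0 \<in> borel_measurable M" "\<And>x. x \<in> space M \<Longrightarrow> \<bar>f0 x\<bar> \<le> 1"
    and f1: "f1 \<in> borel_measurable M" "\<And>x. x \<in> space M \<Longrightarrow> \<bar>f1 x\<bar> \<le> 1"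
    and f2: "f2 \<in> borel_measurable M" "\<And>x. x \<in> space M \<Longrightarrow> \<bar>f2 x\<bar> \<le> 1"
    and mixing: "\<And>\<epsilon>. \<epsilon> > 0 \<Longrightarrow>
      \<exists>\<nu>. \<nu> \<noteq> [] \<and> (\<forall>b. bm b \<longrightarrow> avg \<nu> (\<lambda>t. (ip (\<lambda>x. f1 (T (\<phi> t) x)) b)\<^sup>2) \<le> \<epsilon> * ip b b)"
    and w_psd: "psd (\<lambda>t s. w (t - s))" and w_even: "\<And>g. w (- g) = w g" and w_bdd: "\<And>g. \<bar>w g\<bar> \<le> W"
  shows "mean_zero (\<lambda>g. w g * ip f0 (\<lambda>x. f1 (T (\<phi> g) x) * f2 (T (\<psi> g) x)))"
  unfolding mean_zero_def
proof (intro allI impI)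
  fix \<epsilon> :: real assume "\<epsilon> > 0"
  have \<phi>_add: "\<phi> (s + t) = \<phi> s + \<phi> t" and \<psi>_add: "\<psi> (s + t) = \<psi> s + \<psi> t" for s t
    using hom by (simp_all add: additive_hom_def)
  define \<theta> where "\<theta> g = \<psi> g - \<phi> g" for g
  have hom\<theta>: "additive_hom \<theta>" by (simp add: additive_hom_def \<theta>_def \<phi>_add \<psi>_add)
  have bf: "bm f0" "bm f1" "bm f2" using f0 f1 f2 by (auto intro: bmI)
  have W0: "W \<ge> 0" using w_bdd[of 0] by linarith
  \<comment> \<open>\<open>s\<^sup>2\<close> will bound the fluctuating part of the correlations and
    \<open>s\<close> the mixing part; the value makes the resulting total at most
    \<open>\<epsilon>\<^sup>2\<close>.\<close>
  define s where "s = min 1 (\<epsilon>\<^sup>2 / (W * (1 + W * card R) + 1))"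
  have den: "W * (1 + W * card R) + 1 > 0" using W0 by (simp add: add_nonneg_pos)
  have s: "0 < s" "s \<le> 1" using den \<open>\<epsilon> > 0\<close> by (auto simp: s_def)
  have sW: "W * (s\<^sup>2 + W * (card R * s)) \<le> \<epsilon>\<^sup>2"
  proof -
    have "s\<^sup>2 \<le> s" using s by (simp add: power2_eq_square mult_left_le)
    then have "W * (s\<^sup>2 + W * (card R * s)) \<le> W * (s + W * (card R * s))"
      using W0 by (intro mult_left_mono) auto
    also have "\<dots> \<le> s * (W * (1 + W * card R) + 1)" using s by (simp add: algebra_simps)
    also have "\<dots> \<le> \<epsilon>\<^sup>2 / (W * (1 + W * card R) + 1) * (W * (1 + W * card R) + 1)"
      using den by (intro mult_right_mono) (auto simp: s_def)
    also have "\<dots> = \<epsilon>\<^sup>2" using den by simp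
    finally show ?thesis .
  qed
  obtain e where e: "\<And>r. e r \<in> borel_measurable M" "\<And>r x. x \<in> space M \<Longrightarrow> \<bar>e r x\<bar> \<le> (1::real)"
    "\<And>p C F. p \<in> borel_measurable M \<Longrightarrow> (\<And>x. x \<in> space M \<Longrightarrow> \<bar>p x\<bar> \<le> C) \<Longrightarrow>
      (\<And>g. AE x in M. p (T (\<theta> g) x) = p x) \<Longrightarrow> bm F \<Longrightarrow>
      \<bar>ip F p\<bar> \<le> C * (\<Sum>r\<in>R. \<bar>ip F (e r)\<bar>)"
    using finite_index_invariant_rank[OF hom\<theta> R(1)] R(2) unfolding \<theta>_def by blast
  have be: "bm (e r)" for r using e(1,2) by (rule bmI)
  have "s\<^sup>2 > 0" using s by simp
  from mixing[OF this] obtain H where H: "H \<noteq> []"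
    "\<And>b. bm b \<Longrightarrow> avg H (\<lambda>t. (ip (\<lambda>x. f1 (T (\<phi> t) x)) b)\<^sup>2) \<le> s\<^sup>2 * ip b b" by blast
  define a where "a g = (\<lambda>x. f1 (T (\<phi> g) x) * f2 (T (\<psi> g) x))" for g
  have ba: "bm (a g)" for g unfolding a_def by (intro bm_mult bm_T bf)
  define P where "P h h' = (\<lambda>x. f1 (T (\<phi> h) x) * f1 (T (\<phi> h') x))" for h h'
  define P' where "P' h h' = (\<lambda>x. f2 (T (\<psi> h) x) * f2 (T (\<psi> h') x))" for h h'
  have bP: "bm (P h h')" for h h' unfolding P_def by (intro bm_mult bm_T bf)
  have bP': "bm (P' h h')" for h h' unfolding P'_def by (intro bm_mult bm_T bf)
  have P'_le: "\<bar>P' h h' x\<bar> \<le> 1" if "x \<in> space M" for h h' x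
    unfolding P'_def abs_mult using f2(2) T_space[OF that] by (intro mult_le_one) auto
  define \<gamma> where "\<gamma> h h' g = ip (a (g + h)) (a (g + h'))" for h h' g
  \<comment> \<open>The change of variables by \<open>T (\<phi> g)\<close> removes the common motion
    and leaves only \<open>\<theta> g\<close>, acting on one factor.\<close>
  have \<gamma>: "\<gamma> h h' g = ip (P h h') (\<lambda>x. P' h h' (T (\<theta> g) x))" for h h' g
  proof -
    have "a (g + h) x * a (g + h') x = P h h' (T (\<phi> g) x) * P' h h' (T (\<theta> g) (T (\<phi> g) x))"
      if "x \<in> space M" for x
    proof -
      have "T (\<phi> (g + t)) x = T (\<phi> t) (T (\<phi> g) x)" for t
        using that by (simp add: \<phi>_add T_add[symmetric] add.commute)
      moreover have "T (\<psi> (g + t)) x = T (\<psi> t) (T (\<theta> g) (T (\<phi> g) x))" for t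
        using that T_space by (simp add: \<psi>_add T_add[symmetric] \<theta>_def add.commute)
      ultimately show ?thesis by (simp add: a_def P_def P'_def)
    qed
    then have "\<gamma> h h' g = (\<integral>x. P h h' (T (\<phi> g) x) * P' h h' (T (\<theta> g) (T (\<phi> g) x)) \<partial>M)"
      unfolding \<gamma>_def ip_def by (intro Bochner_Integration.integral_cong) auto
    also have "\<dots> = ip (P h h') (\<lambda>x. P' h h' (T (\<theta> g) x))"
      unfolding ip_def
      by (rule integral_T[of "\<lambda>x. P h h' x * P' h h' (T (\<theta> g) x)"])
        (intro bm_measurable bm_mult bm_T bP bP')
    finally show ?thesis .
  qed
  \<comment> \<open>The invariant limit of the correlations is controlled by the \<open>e r\<close>,
    which do not depend on \<open>h\<close> and \<open>h'\<close>.\<close>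
  have "\<exists>c. mean_zero (\<lambda>g. \<gamma> h h' g - c) \<and> \<bar>c\<bar> \<le> (\<Sum>r\<in>R. \<bar>ip (P h h') (e r)\<bar>)" for h h'
  proof -
    obtain p where p: "p \<in> borel_measurable M" "\<And>x. x \<in> space M \<Longrightarrow> \<bar>p x\<bar> \<le> 1"
      "\<And>g. AE x in M. p (T (\<theta> g) x) = p x"
      "\<And>E. bm E \<Longrightarrow> mean_zero (\<lambda>g. ip E (\<lambda>x. P' h h' (T (\<theta> g) x)) - ip E p)"
      using mean_ergodic[OF hom\<theta> bm_measurable[OF bP', of h h'] P'_le] by blast
    then show ?thesis
      using e(3)[OF p(1-3) bP[of h h']] p(4)[OF bP[of h h']] unfolding \<gamma> by auto
  qed
  then obtain c where c: "\<And>h h'. mean_zero (\<lambda>g. \<gamma> h h' g - c h h')"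
    "\<And>h h'. \<bar>c h h'\<bar> \<le> (\<Sum>r\<in>R. \<bar>ip (P h h') (e r)\<bar>)" by metis
  \<comment> \<open>The fluctuation of the weighted correlations around their mean
    \<open>cc\<close>; the list \<open>L\<close> averaging it away is chosen after
    \<open>H\<close>.\<close>
  define Z where "Z g = avg H (\<lambda>h. avg H (\<lambda>h'. w (h - h') * (\<gamma> h h' g - c h h')))" for g
  have "mean_zero Z" unfolding Z_def by (intro mean_zero_avg mean_zero_cmult c)
  then obtain L where L: "L \<noteq> []" "\<And>x. \<bar>avg L (\<lambda>l. Z (x + l))\<bar> \<le> s\<^sup>2"
    using \<open>s\<^sup>2 > 0\<close> unfolding mean_zero_def by blast
  define cc where "cc = avg H (\<lambda>h. avg H (\<lambda>h'. w (h - h') * c h h'))"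
  have cc: "\<bar>cc\<bar> \<le> W * (card R * s)"
  proof -
    have mix: "avg H (\<lambda>h. \<bar>ip (P h h') (e r)\<bar>) \<le> s" for h' r
    proof (rule power2_le_imp_le)
      \<comment> \<open>Grouping the second factor of \<open>P h h'\<close> with \<open>e r\<close>
        leaves a correlation of \<open>f1\<close> with a function bounded by 1, to which the mixing
        list applies.\<close>
      let ?b = "\<lambda>x. f1 (T (\<phi> h') x) * e r x"
      have b: "bm ?b" by (intro bm_mult bm_T bf be)
      have "(avg H (\<lambda>h. \<bar>ip (P h h') (e r)\<bar>))\<^sup>2 \<le> avg H (\<lambda>h. \<bar>ip (P h h') (e r)\<bar>\<^sup>2)"
        by (rule avg_square_le)
      also have "\<dots> = avg H (\<lambda>t. (ip (\<lambda>x. f1 (T (\<phi> t) x)) ?b)\<^sup>2)"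
        by (simp add: P_def ip_def mult.assoc)
      also have "\<dots> \<le> s\<^sup>2 * ip ?b ?b" by (rule H(2)[OF b])
      also have "ip ?b ?b \<le> 1"
      proof -
        have "nrm ?b \<le> 1"
          using f1(2) e(2) T_space by (intro nrm_le_bound b) (auto simp: abs_mult intro!: mult_le_one)
        then show ?thesis using nrm_nonneg[of ?b] unfolding nrm_square[symmetric] by (simp add: power_le_one)
      qed
      finally show "(avg H (\<lambda>h. \<bar>ip (P h h') (e r)\<bar>))\<^sup>2 \<le> s\<^sup>2" using s by simp
    qed (use s in simp)
    have "\<bar>cc\<bar> \<le> avg H (\<lambda>h. \<bar>avg H (\<lambda>h'. w (h - h') * c h h')\<bar>)" unfolding cc_def by (rule avg_abs)
    also have "\<dots> \<le> avg H (\<lambda>h. avg H (\<lambda>h'. W * (\<Sum>r\<in>R. \<bar>ip (P h h') (e r)\<bar>)))"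
    proof (rule avg_mono)
      fix h
      have "\<bar>avg H (\<lambda>h'. w (h - h') * c h h')\<bar> \<le> avg H (\<lambda>h'. \<bar>w (h - h') * c h h'\<bar>)" by (rule avg_abs)
      also have "\<dots> \<le> avg H (\<lambda>h'. W * (\<Sum>r\<in>R. \<bar>ip (P h h') (e r)\<bar>))"
        unfolding abs_mult by (intro avg_mono mult_mono w_bdd c(2) W0) auto
      finally show "\<bar>avg H (\<lambda>h'. w (h - h') * c h h')\<bar> \<le> avg H (\<lambda>h'. W * (\<Sum>r\<in>R. \<bar>ip (P h h') (e r)\<bar>))" .
    qed
    also have "\<dots> = W * (\<Sum>r\<in>R. avg H (\<lambda>h'. avg H (\<lambda>h. \<bar>ip (P h h') (e r)\<bar>)))"
      by (subst avg_swap) (simp add: avg_cmult avg_sum)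
    also have "\<dots> \<le> W * (\<Sum>r\<in>R. s)"
      by (intro mult_left_mono sum_mono avg_le[OF H(1)] mix W0)
    finally show ?thesis by simp
  qed
  define S where "S g = avg H (\<lambda>h. w (g + h) * ip f0 (a (g + h)))" for g
  have S_le: "(S g)\<^sup>2 \<le> W * (Z g + cc)" for g
  proof -
    \<comment> \<open>\<open>None\<close> is \<open>f0\<close> at position 0 and
      \<open>Some t\<close> is \<open>a t\<close> at position \<open>t\<close>, so the entries
      against \<open>None\<close> carry exactly the weight \<open>w (g + h)\<close>.\<close>
    define Y where "Y i = (case i of None \<Rightarrow> f0 | Some t \<Rightarrow> a t)" for i
    define pos where "pos i = (case i of None \<Rightarrow> 0 | Some t \<Rightarrow> t)" for i :: "'g option"
    let ?k = "\<lambda>i j. w (pos i - pos j) * ip (Y i) (Y j)"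
    let ?xs = "map (\<lambda>h. (1 / real (length H), Some (g + h))) H"
    have "bm (Y i)" for i by (auto simp: Y_def ba bf split: option.split)
    then have psd: "psd ?k" by (intro psd_times_ip psd_pullback[OF w_psd])
    have sym: "?k i j = ?k j i" for i j
      using w_even[of "pos i - pos j"] by (simp add: ip_commute)
    have xs: "(\<Sum>(\<alpha>, i)\<leftarrow>?xs. \<alpha> * F i) = avg H (\<lambda>h. F (Some (g + h)))" for F
      using sum_list_const_mult[of "1 / real (length H)" "\<lambda>h. F (Some (g + h))" H]
      by (simp add: comp_def avg_def)
    have double: "(\<Sum>(\<alpha>, i)\<leftarrow>?xs. \<Sum>(\<beta>, j)\<leftarrow>?xs. \<alpha> * \<beta> * ?k i j) = Z g + cc"
    proof -
      have "(\<Sum>(\<alpha>, i)\<leftarrow>?xs. \<Sum>(\<beta>, j)\<leftarrow>?xs. \<alpha> * \<beta> * ?k i j)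
          = (\<Sum>(\<alpha>, i)\<leftarrow>?xs. \<alpha> * (\<Sum>(\<beta>, j)\<leftarrow>?xs. \<beta> * ?k i j))"
        unfolding case_prod_unfold sum_list_const_mult[symmetric] by (simp only: mult.assoc)
      also have "\<dots> = avg H (\<lambda>h. avg H (\<lambda>h'. w (h - h') * \<gamma> h h' g))"
        unfolding xs by (simp add: pos_def Y_def \<gamma>_def)
      also have "\<dots> = Z g + cc"
        unfolding Z_def cc_def avg_add[symmetric] distrib_left[symmetric] by simp
      finally show ?thesis .
    qed
    have "S g = (\<Sum>(\<alpha>, i)\<leftarrow>?xs. \<alpha> * ?k i None)"
      unfolding xs by (simp add: S_def pos_def Y_def ip_commute[of f0])
    then have "(S g)\<^sup>2 \<le> (Z g + cc) * (w 0 * ip f0 f0)"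
      using psd_Cauchy_Schwarz[where xs = ?xs and j = None, OF psd sym] unfolding double
      by (simp add: pos_def Y_def)
    also have "\<dots> \<le> (Z g + cc) * W"
    proof (rule mult_left_mono)
      show "0 \<le> Z g + cc" using psd unfolding psd_def double[symmetric] by blast
      have "nrm f0 \<le> 1" using f0(2) by (intro nrm_le_bound bf) auto
      then have "ip f0 f0 \<le> 1" using nrm_nonneg[of f0] unfolding nrm_square[symmetric] by (simp add: power_le_one)
      moreover have "w 0 \<le> W" using w_bdd[of 0] by linarith
      ultimately have "w 0 * ip f0 f0 \<le> W * 1" using W0 ip_nonneg[of f0] by (intro mult_mono) auto
      then show "w 0 * ip f0 f0 \<le> W" by simp
    qed
    finally show ?thesis by (simp add: mult.commute)
  qed
  have "\<bar>avg (conv L H) (\<lambda>t. w (x + t) * ip f0 (a (x + t)))\<bar> \<le> \<epsilon>" for x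
  proof -
    have "(avg (conv L H) (\<lambda>t. w (x + t) * ip f0 (a (x + t))))\<^sup>2 = (avg L (\<lambda>l. S (x + l)))\<^sup>2"
      unfolding avg_conv S_def by (simp add: add.assoc)
    also have "\<dots> \<le> avg L (\<lambda>l. (S (x + l))\<^sup>2)" by (rule avg_square_le)
    also have "\<dots> \<le> avg L (\<lambda>l. W * (Z (x + l) + cc))" by (intro avg_mono S_le)
    also have "\<dots> = W * (avg L (\<lambda>l. Z (x + l)) + cc)"
      by (simp add: avg_cmult avg_add avg_const[OF L(1)])
    also have "\<dots> \<le> W * (s\<^sup>2 + W * (card R * s))"
      using L(2)[of x] cc W0 by (intro mult_left_mono add_mono) auto
    also have "\<dots> \<le> \<epsilon>\<^sup>2" by (rule sW)
    finally show ?thesis using \<open>\<epsilon> > 0\<close> abs_le_square_iff[of _ \<epsilon>] by simp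
  qed
  then show "\<exists>\<nu>. \<nu> \<noteq> [] \<and> (\<forall>x. \<bar>avg \<nu> (\<lambda>t. w (x + t) *
      ip f0 (\<lambda>xa. f1 (T (\<phi> (x + t)) xa) * f2 (T (\<psi> (x + t)) xa)))\<bar> \<le> \<epsilon>)"
    using L(1) H(1) by (intro exI[of _ "conv L H"]) (simp add: a_def conv_Nil_iff)
qed

end

section \<open>Large intersections\<close>

lemma finite_index_range_cover:
  assumes "additive_hom \<phi>" "finite_index (range \<phi>)"
  shows "\<exists>R. finite R \<and> (\<forall>g. \<exists>r\<in>R. \<exists>h. g = r + \<phi> h)"
proof -
  define K where "K = {(\<lambda>h. g + h) ` range \<phi> | g. True}"
  define rep where "rep S = (SOME g. S = (\<lambda>h. g + h) ` range \<phi>)" for S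
  have "\<phi> 0 = 0" using assms(1) unfolding additive_hom_def by (metis add_cancel_right_right)
  have "\<exists>r\<in>rep ` K. \<exists>h. g = r + \<phi> h" for g
  proof -
    let ?S = "(\<lambda>h. g + h) ` range \<phi>"
    have "?S = (\<lambda>h. rep ?S + h) ` range \<phi>" unfolding rep_def by (rule someI) simp
    moreover have "g \<in> ?S" using \<open>\<phi> 0 = 0\<close> by (metis add.right_neutral image_eqI rangeI)
    ultimately have "g \<in> (\<lambda>h. rep ?S + h) ` range \<phi>" by simp
    then obtain h where "g = rep ?S + \<phi> h" by blast
    moreover have "?S \<in> K" unfolding K_def by blast
    ultimately show ?thesis by blast
  qed
  moreover have "finite (rep ` K)" using assms(2) unfolding finite_index_def K_def by simp
  ultimately show ?thesis by blast
qed

context mps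
begin

text \<open>The new factor is the Gram kernel of the translates of \<open>k\<close>. Through this
  step the weight is handled by induction on its exponent.\<close>

lemma psd_translate:
  assumes "additive_hom \<phi>" "bm k" "psd (\<lambda>t s. w (t - s))"
  shows "psd (\<lambda>t s. w (t - s) * ip (\<lambda>x. k (T (\<phi> (t - s)) x)) k)"
proof -
  have "ip (\<lambda>x. k (T (\<phi> (t - s)) x)) k = ip (\<lambda>x. k (T (\<phi> t) x)) (\<lambda>x. k (T (\<phi> s) x))" for t s
  proof -
    have "\<phi> t = \<phi> s + \<phi> (t - s)"
      using assms(1) unfolding additive_hom_def by (metis add.commute diff_add_cancel)
    then have "ip (\<lambda>x. k (T (\<phi> t) x)) (\<lambda>x. k (T (\<phi> s) x))
        = ip (\<lambda>x. k (T (\<phi> (t - s)) x)) (\<lambda>x. k (T 0 x))"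
      using ip_T_add[OF assms(2,2), of "\<phi> s" "\<phi> (t - s)" 0] by simp
    also have "\<dots> = ip (\<lambda>x. k (T (\<phi> (t - s)) x)) k"
      by (intro ip_cong) (simp_all add: T_zero)
    finally show ?thesis by simp
  qed
  then show ?thesis using assms(2,3) by (simp add: psd_times_ip bm_T)
qed

lemma ip_T_uminus:
  assumes "additive_hom \<phi>" "bm k"
  shows "ip (\<lambda>x. k (T (\<phi> (- g)) x)) k = ip (\<lambda>x. k (T (\<phi> g) x)) k"
proof -
  have "\<phi> g + \<phi> (- g) = 0"
    using assms(1) unfolding additive_hom_def by (metis add.right_inverse add_cancel_right_right)
  then have "ip (\<lambda>x. k (T 0 x)) (\<lambda>x. k (T (\<phi> g) x)) = ip (\<lambda>x. k (T (\<phi> (- g)) x)) (\<lambda>x. k (T 0 x))"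
    using ip_T_add[OF assms(2,2), of "\<phi> g" "\<phi> (- g)" 0] by simp
  moreover have "ip (\<lambda>x. k (T 0 x)) (\<lambda>x. k (T (\<phi> g) x)) = ip k (\<lambda>x. k (T (\<phi> g) x))"
    "ip (\<lambda>x. k (T (\<phi> (- g)) x)) (\<lambda>x. k (T 0 x)) = ip (\<lambda>x. k (T (\<phi> (- g)) x)) k"
    by (intro ip_cong; simp add: T_zero)+
  ultimately show ?thesis by (simp add: ip_commute)
qed

lemma nrm_T_minus_square:
  assumes "bm k"
  shows "(nrm (\<lambda>x. k (T g x) - k x))\<^sup>2 = 2 * (ip k k - ip (\<lambda>x. k (T g x)) k)"
proof -
  define l where "l = (\<lambda>x. k (T g x))"
  have l: "bm l" "ip l l = ip k k" unfolding l_def using assms by (simp_all add: bm_T ip_T)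
  have "(nrm (\<lambda>x. l x - k x))\<^sup>2 = ip l l - ip l k - (ip l k - ip k k)"
    unfolding nrm_square using l(1) assms
    by (simp only: ip_diff_left ip_diff_right bm_diff ip_commute[of k l])
  then show ?thesis unfolding l(2) by (simp add: l_def)
qed

text \<open>Jensen's inequality for the cube: the tangent at \<open>m\<close> lies below it on the
  nonnegative reals, the gap being \<open>(z - m)\<^sup>2 * (z + 2 * m)\<close>.\<close>

lemma cube_le_ip:
  assumes k: "bm k" "\<And>x. x \<in> space M \<Longrightarrow> 0 \<le> k x" and m: "(\<integral>x. k x \<partial>M) = m"
  shows "m ^ 3 \<le> ip k (\<lambda>x. k x * k x)"
proof -
  have "m \<ge> 0" unfolding m[symmetric] using k(2) by (intro Bochner_Integration.integral_nonneg) auto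
  have "m ^ 3 = (\<integral>x. 3 * m\<^sup>2 * k x - 2 * m ^ 3 \<partial>M)"
    using bm_integrable[OF k(1)] by (simp add: m prob_space power2_eq_square power3_eq_cube)
  also have "\<dots> \<le> ip k (\<lambda>x. k x * k x)"
    unfolding ip_def
  proof (rule integral_mono)
    show "3 * m\<^sup>2 * k x - 2 * m ^ 3 \<le> k x * (k x * k x)" if "x \<in> space M" for x
    proof -
      have "0 \<le> (k x - m)\<^sup>2 * (k x + 2 * m)" using k(2)[OF that] \<open>m \<ge> 0\<close> by simp
      also have "\<dots> = k x * (k x * k x) - (3 * m\<^sup>2 * k x - 2 * m ^ 3)"
        by (simp add: power2_eq_square power3_eq_cube algebra_simps)
      finally show ?thesis by simp
    qed
  qed (intro bm_integrable bm_intros k)+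
  finally show ?thesis .
qed

end

context ergodic_mps
begin

theorem large_intersections_syndetic:
  fixes \<phi> \<psi> :: "'g \<Rightarrow> 'g"
  assumes hom: "additive_hom \<phi>" "additive_hom \<psi>"
    and fi: "finite_index (range \<phi>)" "finite_index (range \<psi>)" "finite_index (range (\<lambda>g. \<phi> g - \<psi> g))"
    and "\<epsilon> > 0" and A [measurable]: "A \<in> sets M"
  shows "syndetic {g. prob (A \<inter> (T (\<phi> g) -` A \<inter> space M) \<inter> (T (\<psi> g) -` A \<inter> space M))
                     > prob A ^ 3 - \<epsilon>}"
proof -
  have \<phi>_add: "\<phi> (s + t) = \<phi> s + \<phi> t" and \<psi>_add: "\<psi> (s + t) = \<psi> s + \<psi> t" for s t
    using hom by (simp_all add: additive_hom_def)
  define f where "f = indicat_real A"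
  define m where "m = prob A"
  have f_meas: "f \<in> borel_measurable M" unfolding f_def by measurable
  have f01: "0 \<le> f x \<and> f x \<le> 1" for x by (simp add: f_def)
  obtain k where k: "ap k" "\<And>x. x \<in> space M \<Longrightarrow> 0 \<le> k x \<and> k x \<le> 1"
    "\<And>l. ap l \<Longrightarrow> ip (\<lambda>x. f x - k x) l = 0"
    using ap_projection[OF f_meas f01] by blast
  define u where "u = (\<lambda>x. f x - k x)"
  have bf: "bm f" unfolding f_def using A by (rule bm_indicator)
  have bk: "bm k" using k(1) by (rule ap_bm)
  have bu: "bm u" unfolding u_def using bf bk by (rule bm_diff)
  have f1: "\<bar>f x\<bar> \<le> 1" for x using f01 by simp
  have k1: "\<bar>k x\<bar> \<le> 1" if "x \<in> space M" for x using k(2)[OF that] by simp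
  have u1: "\<bar>u x\<bar> \<le> 1" if "x \<in> space M" for x
    using k(2)[OF that] f01[of x] unfolding u_def by linarith

  \<comment> \<open>Splitting the triple intersection into a main term and two errors\<close>
  define I where "I g = ip f (\<lambda>x. f (T (\<phi> g) x) * f (T (\<psi> g) x))" for g
  define J where "J g = ip f (\<lambda>x. k (T (\<phi> g) x) * k (T (\<psi> g) x))" for g
  define E1 where "E1 g = ip f (\<lambda>x. u (T (\<phi> g) x) * f (T (\<psi> g) x))" for g
  \<comment> \<open>The factor with \<open>u\<close> comes first, so that the estimate for
    \<open>E1\<close> applies with \<phi> and \<psi> exchanged.\<close>
  define E2 where "E2 g = ip f (\<lambda>x. u (T (\<psi> g) x) * k (T (\<phi> g) x))" for g
  have I_eq: "prob (A \<inter> (T (\<phi> g) -` A \<inter> space M) \<inter> (T (\<psi> g) -` A \<inter> space M)) = I g" for g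
  proof -
    have "I g = (\<integral>x. indicat_real (A \<inter> (T (\<phi> g) -` A \<inter> space M) \<inter> (T (\<psi> g) -` A \<inter> space M)) x \<partial>M)"
      unfolding I_def ip_def f_def
      by (intro Bochner_Integration.integral_cong) (auto simp: indicator_def)
    then show ?thesis by simp
  qed
  have IJ: "I g = J g + (E1 g + E2 g)" for g
  proof -
    have "(\<lambda>x. f (T (\<phi> g) x) * f (T (\<psi> g) x)) = (\<lambda>x. k (T (\<phi> g) x) * k (T (\<psi> g) x) +
        (u (T (\<phi> g) x) * f (T (\<psi> g) x) + u (T (\<psi> g) x) * k (T (\<phi> g) x)))"
      by (simp add: u_def algebra_simps)
    then show ?thesis unfolding I_def J_def E1_def E2_def
      by (simp add: ip_add_right bm_add bm_mult bm_T bf bk bu)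
  qed

  \<comment> \<open>The weight of positive type\<close>
  define a where "a g = ip (\<lambda>x. k (T (\<phi> g) x)) k + ip (\<lambda>x. k (T (\<psi> g) x)) k" for g
  define w where "w n g = (1 + a g) ^ n" for n g
  have ip_kT: "0 \<le> ip (\<lambda>x. k (T g x)) k \<and> ip (\<lambda>x. k (T g x)) k \<le> ip k k" for g
  proof
    show "0 \<le> ip (\<lambda>x. k (T g x)) k"
      unfolding ip_def using k(2) T_space by (intro Bochner_Integration.integral_nonneg) auto
    show "ip (\<lambda>x. k (T g x)) k \<le> ip k k"
      using zero_le_power2[of "nrm (\<lambda>x. k (T g x) - k x)"] unfolding nrm_T_minus_square[OF bk] by simp
  qed
  have ip_kk: "ip k k \<le> 1"
  proof -
    have "nrm k \<le> 1" using k1 by (intro nrm_le_bound bk) auto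
    then show ?thesis using nrm_nonneg[of k] unfolding nrm_square[symmetric] by (simp add: power_le_one)
  qed
  have a_bounds: "0 \<le> a g \<and> a g \<le> 2 * ip k k" for g
    using ip_kT[of "\<phi> g"] ip_kT[of "\<psi> g"] unfolding a_def by linarith
  have w_nonneg: "0 \<le> w n g" for n g using a_bounds[of g] by (simp add: w_def)
  have w_bdd: "\<bar>w n g\<bar> \<le> 3 ^ n" for n g
    using a_bounds[of g] ip_kk unfolding w_def by (simp add: power_mono)
  have w_even: "w n (- g) = w n g" for n g
    unfolding w_def a_def using ip_T_uminus[OF hom(1) bk] ip_T_uminus[OF hom(2) bk] by simp
  have w_psd: "psd (\<lambda>t s. w n (t - s))" for n
  proof (induction n)
    case 0 then show ?case by (simp add: w_def psd_one)
  next
    case (Suc n)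
    have "psd (\<lambda>t s. w n (t - s) + (w n (t - s) * ip (\<lambda>x. k (T (\<phi> (t - s)) x)) k
        + w n (t - s) * ip (\<lambda>x. k (T (\<psi> (t - s)) x)) k))"
      by (intro psd_add Suc psd_translate hom bk)
    then show ?case by (simp add: w_def a_def algebra_simps)
  qed

  \<comment> \<open>Vanishing of the weighted error terms\<close>
  obtain R\<phi> where R\<phi>: "finite R\<phi>" "\<And>g. \<exists>r\<in>R\<phi>. \<exists>h. g = r + \<phi> h"
    using finite_index_range_cover[OF hom(1) fi(1)] by blast
  obtain R\<psi> where R\<psi>: "finite R\<psi>" "\<And>g. \<exists>r\<in>R\<psi>. \<exists>h. g = r + \<psi> h"
    using finite_index_range_cover[OF hom(2) fi(2)] by blast
  have "additive_hom (\<lambda>g. \<phi> g - \<psi> g)" by (simp add: additive_hom_def \<phi>_add \<psi>_add)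
  then obtain R where R: "finite R" "\<And>g. \<exists>r\<in>R. \<exists>h. g = r + (\<phi> h - \<psi> h)"
    using finite_index_range_cover[OF _ fi(3)] by blast
  have R': "\<exists>r\<in>R. \<exists>h. g = r + (\<psi> h - \<phi> h)" for g
  proof -
    obtain r h where r: "r \<in> R" "g = r + (\<phi> h - \<psi> h)" using R(2) by blast
    have "\<phi> 0 = 0" "\<psi> 0 = 0" using \<phi>_add[of 0 0] \<psi>_add[of 0 0] by simp_all
    then have "\<phi> h + \<phi> (- h) = 0" "\<psi> h + \<psi> (- h) = 0"
      using \<phi>_add[of h "- h"] \<psi>_add[of h "- h"] by simp_all
    then have "\<phi> (- h) = - \<phi> h" "\<psi> (- h) = - \<psi> h" by (simp_all add: add_eq_0_iff)
    then have "g = r + (\<psi> (- h) - \<phi> (- h))" using r(2) by simp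
    then show ?thesis using r(1) by blast
  qed
  have orth: "ip u l = 0" if "ap l" for l unfolding u_def by (rule k(3)[OF that])
  note um = bm_measurable[OF bu] and km = bm_measurable[OF bk]
  have E1: "mean_zero (\<lambda>g. w n g * E1 g)" for n
    unfolding E1_def
    by (rule weighted_van_der_Corput[OF hom R(1) R' f_meas f1 um u1 f_meas f1
          mixing_of_orthogonal_ap[OF bu orth hom(1) R\<phi>] w_psd w_even w_bdd])
  have E2: "mean_zero (\<lambda>g. w n g * E2 g)" for n
    unfolding E2_def
    by (rule weighted_van_der_Corput[OF hom(2,1) R f_meas f1 um u1 km k1
          mixing_of_orthogonal_ap[OF bu orth hom(2) R\<psi>] w_psd w_even w_bdd])
  have E: "mean_zero (\<lambda>g. w n g * (E1 g + E2 g))" for n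
    using mean_zero_add[OF E1 E2, of n n] by (simp add: distrib_left)

  \<comment> \<open>Lower bounds for the main term\<close>
  define \<delta> where "\<delta> = min 1 (\<epsilon>\<^sup>2 / 32)"
  \<comment> \<open>\<open>2 * \<delta> \<le> (\<epsilon> / 4)\<^sup>2\<close> lets \<open>k\<close>
    move by at most \<open>\<epsilon> / 4\<close> under each of two translations, which leaves a
    margin of \<open>\<epsilon> / 2\<close>; \<open>\<delta> \<le> 1\<close> keeps \<open>x2\<close>
    below nonnegative.\<close>
  have \<delta>: "0 < \<delta>" "\<delta> \<le> 1" "\<delta> \<le> \<epsilon>\<^sup>2 / 32" using \<open>\<epsilon> > 0\<close> by (auto simp: \<delta>_def)
  have m3: "m ^ 3 \<le> ip f (\<lambda>x. k x * k x)"
  proof -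
    have "ip u (\<lambda>x. 1) = 0" by (intro orth ap_const)
    then have "ip f (\<lambda>x. 1) = ip k (\<lambda>x. 1)"
      unfolding u_def ip_diff_left[OF bf bk bm_const] by simp
    then have "(\<integral>x. k x \<partial>M) = m" by (simp add: ip_def f_def m_def)
    then have "m ^ 3 \<le> ip k (\<lambda>x. k x * k x)" using k(2) by (intro cube_le_ip bk) auto
    \<comment> \<open>The square of \<open>k\<close> is almost periodic too, so \<open>f\<close> may
      be replaced by \<open>k\<close> in the remaining factor.\<close>
    moreover have "ip u (\<lambda>x. k x * k x) = 0"
    proof (rule orth, rule ap_compose[where L = 2 and \<Phi> = "\<lambda>z. z * z"])
      show "\<bar>k x * k x - k y * k y\<bar> \<le> 2 * \<bar>k x - k y\<bar>" if "x \<in> space M" "y \<in> space M" for x y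
      proof -
        have "\<bar>k x * k x - k y * k y\<bar> = \<bar>k x + k y\<bar> * \<bar>k x - k y\<bar>"
          unfolding abs_mult[symmetric] by (simp add: algebra_simps)
        also have "\<dots> \<le> 2 * \<bar>k x - k y\<bar>"
          using k(2)[OF that(1)] k(2)[OF that(2)] by (intro mult_right_mono) auto
        finally show ?thesis .
      qed
    qed (use k(1) bk in \<open>auto intro: bm_mult\<close>)
    ultimately show ?thesis
      unfolding u_def ip_diff_left[OF bf bk bm_mult[OF bk bk]] by simp
  qed
  have m01: "0 \<le> m" "m \<le> 1" by (simp_all add: m_def)
  have J_near: "\<epsilon> / 2 \<le> J g - (m ^ 3 - \<epsilon>)" if g: "2 * ip k k - \<delta> \<le> a g" for g
  proof -
    have small: "nrm (\<lambda>x. k (T h x) - k x) \<le> \<epsilon> / 4" if "ip k k - ip (\<lambda>x. k (T h x)) k \<le> \<delta>" for h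
    proof (rule power2_le_imp_le)
      show "(nrm (\<lambda>x. k (T h x) - k x))\<^sup>2 \<le> (\<epsilon> / 4)\<^sup>2"
        unfolding nrm_T_minus_square[OF bk] using that \<delta>(3) by (simp add: power_divide)
    qed (use \<open>\<epsilon> > 0\<close> in simp)
    \<comment> \<open>Each summand of \<open>a g\<close> is at most \<open>ip k k\<close>, so the
      total deficit bounds each single one.\<close>
    have n: "nrm (\<lambda>x. k (T (\<phi> g) x) - k x) \<le> \<epsilon> / 4" "nrm (\<lambda>x. k (T (\<psi> g) x) - k x) \<le> \<epsilon> / 4"
      using g ip_kT[of "\<phi> g"] ip_kT[of "\<psi> g"] unfolding a_def by (intro small; linarith)+
    have low: "- \<epsilon> / 4 \<le> ip p (\<lambda>x. k (T h x) - k x)"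
      if p: "bm p" "\<And>x. x \<in> space M \<Longrightarrow> \<bar>p x\<bar> \<le> 1" and h: "nrm (\<lambda>x. k (T h x) - k x) \<le> \<epsilon> / 4" for p h
    proof -
      have "\<bar>ip p (\<lambda>x. k (T h x) - k x)\<bar> \<le> nrm p * nrm (\<lambda>x. k (T h x) - k x)"
        by (intro ip_le_nrm p bm_diff bm_T bk)
      also have "\<dots> \<le> 1 * (\<epsilon> / 4)"
        using nrm_le_bound[OF p] by (intro mult_mono h nrm_nonneg) auto
      finally show ?thesis by linarith
    qed
    have "J g - ip f (\<lambda>x. k x * k x) = ip (\<lambda>x. f x * k (T (\<psi> g) x)) (\<lambda>x. k (T (\<phi> g) x) - k x)
        + ip (\<lambda>x. f x * k x) (\<lambda>x. k (T (\<psi> g) x) - k x)"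
    proof -
      have "(\<lambda>x. f x * (k (T (\<phi> g) x) * k (T (\<psi> g) x))) =
          (\<lambda>x. f x * (k x * k x) + ((f x * k (T (\<psi> g) x)) * (k (T (\<phi> g) x) - k x)
            + (f x * k x) * (k (T (\<psi> g) x) - k x)))"
        by (simp add: algebra_simps)
      then show ?thesis unfolding J_def ip_def
        by (simp add: bm_integrable bm_add bm_mult bm_diff bm_T bf bk)
    qed
    moreover have "- \<epsilon> / 4 \<le> ip (\<lambda>x. f x * k (T (\<psi> g) x)) (\<lambda>x. k (T (\<phi> g) x) - k x)"
      using f1 k1 T_space by (intro low n bm_mult bf bm_T bk) (auto simp: abs_mult intro!: mult_le_one)
    moreover have "- \<epsilon> / 4 \<le> ip (\<lambda>x. f x * k x) (\<lambda>x. k (T (\<psi> g) x) - k x)"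
      using f1 k1 by (intro low n bm_mult bf bk) (auto simp: abs_mult intro!: mult_le_one)
    ultimately show ?thesis using m3 by linarith
  qed
  have J_far: "- 1 \<le> J g - (m ^ 3 - \<epsilon>)" for g
  proof -
    have "0 \<le> J g" unfolding J_def ip_def
      using f01 k(2) T_space by (intro Bochner_Integration.integral_nonneg) auto
    moreover have "m ^ 3 \<le> 1" using m01 by (simp add: power_le_one)
    ultimately show ?thesis using \<open>\<epsilon> > 0\<close> by linarith
  qed

  \<comment> \<open>The threshold \<open>\<delta> / 2\<close> is stricter than the
    \<open>\<delta>\<close> of \<open>J_near\<close>; this gap lets a high power on \<open>B\<close>
    outweigh the region where only \<open>J_far\<close> is available.\<close>
  define B where "B = {g. 2 * ip k k - \<delta> / 2 \<le> a g}"
  have "\<exists>F. finite F \<and> F \<noteq> {} \<and> (\<forall>x. \<exists>t\<in>F. x - t \<in> B)"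
  proof -
    \<comment> \<open>With this radius each term of \<open>a\<close> loses at most
      \<open>\<delta> / 4\<close>, together the \<open>\<delta> / 2\<close> allowed in
      \<open>B\<close>.\<close>
    have "sqrt (\<delta> / 2) > 0" using \<delta>(1) by simp
    from apD[OF k(1) this] obtain c :: "'g \<Rightarrow> nat" where c: "finite (range c)"
      "\<And>g h. c g = c h \<Longrightarrow> nrm (\<lambda>x. k (T g x) - k (T h x)) \<le> sqrt (\<delta> / 2)" by blast
    define d where "d g = (c (\<phi> g), c (\<psi> g))" for g
    have "range d \<subseteq> range c \<times> range c" by (auto simp: d_def)
    then have fin: "finite (range d)" using c(1) by (meson finite_SigmaI finite_subset)
    \<comment> \<open>One representative per colour: if \<open>t\<close> and \<open>x\<close> share
      a colour, \<open>\<phi> (x - t)\<close> and \<open>\<psi> (x - t)\<close> both nearly fix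
      \<open>k\<close>.\<close>
    define F where "F = inv d ` range d"
    have "x - inv d (d x) \<in> B" for x
    proof -
      define t where "t = inv d (d x)"
      have "d t = d x" unfolding t_def by (simp add: f_inv_into_f)
      then have c_eq: "c (\<phi> x) = c (\<phi> t)" "c (\<psi> x) = c (\<psi> t)" by (simp_all add: d_def)
      have *: "ip k k - ip (\<lambda>y. k (T (\<xi> (x - t)) y)) k \<le> \<delta> / 4"
        if \<xi>: "\<And>s t. \<xi> (s + t) = \<xi> s + \<xi> t" "c (\<xi> x) = c (\<xi> t)" for \<xi>
      proof -
        have "\<xi> x = \<xi> t + \<xi> (x - t)" using \<xi>(1)[of t "x - t"] by simp
        then have "nrm (\<lambda>y. k (T (\<xi> (x - t)) y) - k (T 0 y)) \<le> sqrt (\<delta> / 2)"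
          using c(2)[OF \<xi>(2)] nrm_T_add[OF bk, of "\<xi> t" "\<xi> (x - t)" 0] by simp
        moreover have "nrm (\<lambda>y. k (T (\<xi> (x - t)) y) - k (T 0 y)) = nrm (\<lambda>y. k (T (\<xi> (x - t)) y) - k y)"
          by (intro nrm_cong) (simp add: T_zero)
        ultimately have "(nrm (\<lambda>y. k (T (\<xi> (x - t)) y) - k y))\<^sup>2 \<le> (sqrt (\<delta> / 2))\<^sup>2"
          using nrm_nonneg by (intro power_mono) auto
        then show ?thesis unfolding nrm_T_minus_square[OF bk] using \<delta>(1) by simp
      qed
      show ?thesis
        using *[OF \<phi>_add c_eq(1)] *[OF \<psi>_add c_eq(2)] unfolding B_def a_def t_def by simp
    qed
    moreover have "inv d (d x) \<in> F" for x unfolding F_def by blast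
    ultimately show ?thesis using fin unfolding F_def by (intro exI[of _ F]) (auto simp: F_def)
  qed
  then obtain F where F: "finite F" "F \<noteq> {}" "\<And>x. \<exists>t\<in>F. x - t \<in> B" by blast
  obtain Fl where Fl: "set Fl = F" using finite_list[OF F(1)] by blast
  define \<nu>0 where "\<nu>0 = map uminus Fl"
  have \<nu>0: "\<nu>0 \<noteq> []" using Fl F(2) by (auto simp: \<nu>0_def)
  \<comment> \<open>Every translate of \<open>\<nu>0\<close> meets \<open>B\<close>, so
    \<open>c0\<close> bounds the density of \<open>B\<close> from below, independently of the
    exponent chosen later.\<close>
  define c0 where "c0 = 1 / real (length \<nu>0)"
  have c0: "c0 > 0" using \<nu>0 by (simp add: c0_def)
  have dense: "c0 \<le> avg \<nu>0 (\<lambda>t. indicat_real B (x + t))" for x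
  proof -
    obtain t where "t \<in> F" "x - t \<in> B" using F(3) by blast
    then have t: "- t \<in> set \<nu>0" "x + (- t) \<in> B" using Fl by (auto simp: \<nu>0_def)
    have "1 = indicat_real B (x + (- t))" using t(2) by simp
    also have "\<dots> \<le> (\<Sum>t\<leftarrow>\<nu>0. indicat_real B (x + t))"
      using imageI[OF t(1), of "\<lambda>t. indicat_real B (x + t)"] by (intro member_le_sum_list) auto
    finally show ?thesis unfolding avg_def c0_def by (intro divide_right_mono) auto
  qed

  \<comment> \<open>Choice of the exponent and comparison with the errors\<close>
  define x1 x2 where "x1 = 1 + 2 * ip k k - \<delta> / 2" and "x2 = 1 + 2 * ip k k - \<delta>"
  have x12: "0 \<le> x2" "x2 < x1" using \<delta> ip_nonneg[of k] by (auto simp: x1_def x2_def)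
  have "x2 / x1 < 1" "0 < \<epsilon> / 2 * c0" using x12 c0 \<open>\<epsilon> > 0\<close> by auto
  \<comment> \<open>The gain from \<open>B\<close>, at least
    \<open>\<epsilon> / 2 * c0 * x1 ^ n\<close>, has to exceed the loss, at most
    \<open>x2 ^ n\<close>; \<open>\<eta>\<close> is the surplus.\<close>
  then obtain n where n: "(x2 / x1) ^ n < \<epsilon> / 2 * c0" using real_arch_pow_inv by blast
  define \<eta> where "\<eta> = \<epsilon> / 2 * c0 * x1 ^ n - x2 ^ n"
  have "x1 ^ n > 0" using x12 by simp
  then have \<eta>: "\<eta> > 0" using n by (simp add: \<eta>_def power_divide field_simps)
  have wJ: "\<epsilon> / 2 * x1 ^ n * indicat_real B g - x2 ^ n \<le> w n g * (J g - (m ^ 3 - \<epsilon>))" for g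
  proof (cases "2 * ip k k - \<delta> \<le> a g")
    case True
    have "\<epsilon> / 2 * x1 ^ n * indicat_real B g \<le> \<epsilon> / 2 * w n g"
    proof (cases "g \<in> B")
      case True
      then have "x1 \<le> 1 + a g" by (simp add: B_def x1_def)
      then have "x1 ^ n \<le> w n g" unfolding w_def using x12 by (intro power_mono) auto
      then show ?thesis using \<open>\<epsilon> > 0\<close> True by simp
    qed (use w_nonneg \<open>\<epsilon> > 0\<close> in simp)
    also have "\<dots> \<le> w n g * (J g - (m ^ 3 - \<epsilon>))"
      using mult_left_mono[OF J_near[OF True] w_nonneg[of n g]] by (simp add: mult.commute)
    finally show ?thesis using zero_le_power[OF x12(1), of n] by linarith
  next
    case False
    then have "g \<notin> B" using \<delta>(1) by (simp add: B_def)
    have "w n g \<le> x2 ^ n"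
      unfolding w_def using False a_bounds[of g] by (intro power_mono) (auto simp: x2_def)
    moreover have "w n g * (- 1) \<le> w n g * (J g - (m ^ 3 - \<epsilon>))"
      by (intro mult_left_mono J_far w_nonneg)
    ultimately show ?thesis using \<open>g \<notin> B\<close> by simp
  qed
  have avg_J: "\<eta> \<le> avg \<nu>0 (\<lambda>t. w n (x + t) * (J (x + t) - (m ^ 3 - \<epsilon>)))" for x
  proof -
    have "\<epsilon> / 2 * x1 ^ n * c0 \<le> \<epsilon> / 2 * x1 ^ n * avg \<nu>0 (\<lambda>t. indicat_real B (x + t))"
      using \<open>\<epsilon> > 0\<close> \<open>x1 ^ n > 0\<close> by (intro mult_left_mono dense) auto
    then have "\<eta> \<le> avg \<nu>0 (\<lambda>t. \<epsilon> / 2 * x1 ^ n * indicat_real B (x + t) - x2 ^ n)"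
      unfolding avg_diff avg_cmult avg_const[OF \<nu>0] \<eta>_def by (simp add: mult_ac)
    also have "\<dots> \<le> avg \<nu>0 (\<lambda>t. w n (x + t) * (J (x + t) - (m ^ 3 - \<epsilon>)))"
      by (intro avg_mono wJ)
    finally show ?thesis .
  qed
  obtain \<nu> where \<nu>: "\<nu> \<noteq> []" "\<And>x. \<bar>avg \<nu> (\<lambda>t. w n (x + t) * (E1 (x + t) + E2 (x + t)))\<bar> \<le> \<eta> / 2"
    using E[of n, unfolded mean_zero_def, rule_format, of "\<eta> / 2"] \<eta> by auto
  \<comment> \<open>The main term is bounded below over every translate of \<open>\<nu>0\<close> and
    the error over every translate of \<open>\<nu>\<close>, so the convolution satisfies both. As
    \<open>w n\<close> is nonnegative, a positive average forces a good element in each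
    translate.\<close>
  let ?\<nu> = "conv \<nu> \<nu>0"
  have "\<exists>t\<in>set ?\<nu>. I (x + t) > m ^ 3 - \<epsilon>" for x
  proof (rule ccontr)
    assume neg: "\<not> ?thesis"
    have "avg ?\<nu> (\<lambda>t. w n (x + t) * (I (x + t) - (m ^ 3 - \<epsilon>))) \<le> 0"
      using neg \<nu>(1) \<nu>0
      by (intro avg_le) (auto simp: conv_Nil_iff not_less intro!: mult_nonneg_nonpos w_nonneg)
    moreover have "avg ?\<nu> (\<lambda>t. w n (x + t) * (I (x + t) - (m ^ 3 - \<epsilon>))) =
        avg ?\<nu> (\<lambda>t. w n (x + t) * (J (x + t) - (m ^ 3 - \<epsilon>)))
        + avg ?\<nu> (\<lambda>t. w n (x + t) * (E1 (x + t) + E2 (x + t)))"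
      unfolding avg_add[symmetric] IJ by (simp add: algebra_simps)
    moreover have "\<eta> \<le> avg ?\<nu> (\<lambda>t. w n (x + t) * (J (x + t) - (m ^ 3 - \<epsilon>)))"
      unfolding avg_conv add.assoc[symmetric] by (rule avg_ge[OF \<nu>(1) avg_J])
    moreover have "- (\<eta> / 2) \<le> avg ?\<nu> (\<lambda>t. w n (x + t) * (E1 (x + t) + E2 (x + t)))"
    proof -
      have "avg ?\<nu> (\<lambda>t. w n (x + t) * (E1 (x + t) + E2 (x + t)))
          = avg \<nu>0 (\<lambda>h. avg \<nu> (\<lambda>t. w n ((x + h) + t) * (E1 ((x + h) + t) + E2 ((x + h) + t))))"
        unfolding avg_conv by (subst avg_swap) (simp add: ac_simps)
      also have "\<bar>\<dots>\<bar> \<le> \<eta> / 2" by (rule avg_abs_le[OF \<nu>0 \<nu>(2)])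
      finally show ?thesis by linarith
    qed
    ultimately show False using \<eta> by linarith
  qed
  then obtain \<tau> where \<tau>: "\<And>x. \<tau> x \<in> set ?\<nu>" "\<And>x. I (x + \<tau> x) > m ^ 3 - \<epsilon>" by metis
  have "x \<in> (\<lambda>s. - \<tau> x + s) ` {g. I g > m ^ 3 - \<epsilon>}" for x
    using \<tau>(2)[of x] by (intro image_eqI[of _ _ "x + \<tau> x"]) simp_all
  then have "x \<in> (\<Union>g\<in>uminus ` set ?\<nu>. (\<lambda>s. g + s) ` {g. I g > m ^ 3 - \<epsilon>})" for x
    using \<tau>(1) by blast
  then show ?thesis unfolding syndetic_def I_eq m_def
    by (intro exI[of _ "uminus ` set ?\<nu>"]) (auto simp: m_def)
qed

end

theorem theorem1p10:
  fixes \<phi> \<psi> :: "'g::{ab_group_add, countable} \<Rightarrow> 'g"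
    and M :: "'x measure" and T :: "'g \<Rightarrow> 'x \<Rightarrow> 'x"
    and \<epsilon> :: real and A :: "'x set"
  assumes "additive_hom \<phi>" and "additive_hom \<psi>"
    and "finite_index (range \<phi>)" and "finite_index (range \<psi>)"
    and "finite_index (range (\<lambda>g. \<phi> g - \<psi> g))"
    and "ergodic_system M T"
    and "\<epsilon> > 0" and "A \<in> sets M"
  shows "syndetic {g. measure M (A \<inter> (T (\<phi> g) -` A \<inter> space M) \<inter> (T (\<psi> g) -` A \<inter> space M))
                     > measure M A ^ 3 - \<epsilon>}"
proof -
  interpret prob_space M using assms(6) by (simp add: ergodic_system_def mp_system_def)
  interpret ergodic_mps M T
    using assms(6) unfolding ergodic_system_def mp_system_def by unfold_locales auto
  show ?thesis by (rule large_intersections_syndetic[OF assms(1-5,7,8)])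
qed

end
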